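(* Let $\mathcal F=\{a_1,\dots,a_s\}$ be a finite reduced collection of forbidden words over a symbol set $\Sigma$ of size $q\ge2$ with $\Sigma_{\mathcal F}$ irreducible, let $\mathcal R=\{r_1(m_1),\dots,r_\ell(m_\ell)\}$ be a reduced collection of repeated words, let $p\ge2$ be the length of the longest word in $\mathcal F\cup\mathcal R$, and suppose all words in $\mathcal R$ have length $p$. Let $\theta$ be the Perron eigenvalue of the adjacency matrix $A$ associated with $\mathcal F$ and $\mathcal R$. For $X\in\mathcal L_{p-1}$ define $$U_X=1-\theta\sum_{i=1}^{\ell}\Bigl(1-\frac1{m_i}\Bigr)R_i(\theta)(\tilde r_i,X)_\theta+\theta\sum_{j=1}^{s}R_{\ell+j}(\theta)(\tilde a_j,X)_\theta,$$ $$V_X=1-\theta\sum_{i=1}^{\ell}\Bigl(1-\frac1{m_i}\Bigr)S_i(\theta)(X,r_i)_\theta+\theta\sum_{j=1}^{s}S_{\ell+j}(\theta)(X,a_j)_\theta,$$ where $\tilde r_i,\tilde a_j$ are the words obtained by removing the first symbol of $r_i,a_j$ respectively. Then $U=(U_X)_{X\in\mathcal L_{p-1}}$ and $V=(V_X)_{X\in\mathcal L_{p-1}}$ are respectively left and right Perron eigenvectors of $A$.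
   Context: $\Sigma$ is a finite set of $q$ symbols; a word is a finite sequence over $\Sigma$ and $|w|$ is its length. A collection of words is reduced if for any two distinct words in it neither is a (contiguous) subword of the other. $\mathcal F$ is a finite reduced collection of words of length at least $2$; $\Sigma_{\mathcal F}\subseteq\Sigma^{\mathbb N}$ is the set of one-sided sequences containing no word of $\mathcal F$. A word is allowed if it is a subword of some sequence in $\Sigma_{\mathcal F}$; $\mathcal L_n$ is the set of allowed words of length $n$. All symbols are assumed allowed. $\Sigma_{\mathcal F}$ is irreducible: for all allowed $u,v$ there is a word $w$ with $uwv$ allowed. $\mathcal R$ is a finite reduced collection of allowed words $r_1,\dots,r_\ell$, each $r_i$ assigned an integer multiplicity $m_i\ge2$. For an allowed word $w$, $m(w)=\prod_{i}m_i^{n(w;r_i)}$, where $n(w;r_i)$ is the number of occurrences of $r_i$ as a subword of $w$. For $X=x_1\dots x_{p-1}$, $Y=y_1\dots y_{p-1}$ in $\mathcal L_{p-1}$, $X*Y$ is defined only if $x_2\dots x_{p-1}=y_1\dots y_{p-2}$ (no condition if $p=2$), and then $X*Y=x_1\dots x_{p-1}y_{p-1}$. Since all words of $\mathcal R$ have length $p$, the adjacency matrix $A$ associated with $\mathcal F$ and $\mathcal R$ is the matrix indexed by $\mathcal L_{p-1}$ with $A_{XY}=m(X*Y)$ if $X*Y$ is defined and lies in $\mathcal L_p$, and $A_{XY}=0$ otherwise. Correlation: for words $u,v$, $(u,v)=(c_1,\dots,c_{|u|})$ where $c_i=1$ if, placing $v$ below $u$ so that the leftmost symbol of $v$ lies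 under the $i$-th symbol of $u$, the overlapping segments are identical, and $c_i=0$ otherwise; $(u,v)_z=\sum_{i=1}^{|u|}c_iz^{|u|-i}$, and $(u,v)_\theta$ is its value at $z=\theta$. $P(z)$ is the $(\ell+s)\times(\ell+s)$ matrix $$P(z)_{ij}=\begin{cases}z(1-\frac1{m_j})(r_j,r_i)_z-\delta_{ij}z^{|r_j|}, & 1\le i,j\le\ell,\\ -z(a_{j-\ell},r_i)_z, & i\le\ell<j,\\ z(1-\frac1{m_j})(r_j,a_{i-\ell})_z, & j\le\ell<i,\\ -z(a_{j-\ell},a_{i-\ell})_z, & i,j>\ell,\end{cases}$$ which is invertible over the rational functions. $D(z)$ is diagonal with $D_{ii}(z)=z(1-\frac1{m_i})$ for $1\le i\le\ell$ and $D_{ii}(z)=-z$ for $\ell<i\le\ell+s$; $Q=D^{-1}P^TD$. $R_i(z)$ and $S_i(z)$ are the $i$-th row sums of $P^{-1}(z)$ and $Q^{-1}(z)$, viewed as rational functions; $R_i(\theta)$, $S_i(\theta)$ are their values at $\theta$, which exist. Left/right Perron eigenvectors are eigenvectors for the Perron root: $U^TA=\theta U^T$, $AV=\theta V$, $U,V\ne0$. *)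

theory Defs
  imports
    "HOL-Library.Sublist"
    "HOL-Computational_Algebra.Computational_Algebra"
    "HOL-Computational_Algebra.Field_as_Ring"
    "Jordan_Normal_Form.Gauss_Jordan_Elimination"
    "Jordan_Normal_Form.Spectral_Radius"
begin

text \<open>
  The symbol set is a finite type, words are lists over it, and a contiguous
  subword is \<^const>\<open>sublist\<close>. A finite collection \<open>{a\<^sub>1, \<dots>, a\<^sub>s}\<close> of words
  is given by a list without repetitions; all indices start at 0. The multiplicity of
  the word \<open>rep ! i\<close> is \<open>m i\<close>.
\<close>

definition reduced :: "'a list set \<Rightarrow> bool" where
  "reduced C \<longleftrightarrow> (\<forall>u\<in>C. \<forall>v\<in>C. u \<noteq> v \<longrightarrow> \<not> sublist u v)"

definition occurs_in_seq :: "'a list \<Rightarrow> (nat \<Rightarrow> 'a) \<Rightarrow> bool" where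
  "occurs_in_seq w x \<longleftrightarrow> (\<exists>k. \<forall>i<length w. x (k + i) = w ! i)"

definition subshift :: "'a list set \<Rightarrow> (nat \<Rightarrow> 'a) set" where
  "subshift F = {x. \<forall>w\<in>F. \<not> occurs_in_seq w x}"

definition allowed :: "'a list set \<Rightarrow> 'a list \<Rightarrow> bool" where
  "allowed F w \<longleftrightarrow> (\<exists>x\<in>subshift F. occurs_in_seq w x)"

definition lang :: "'a list set \<Rightarrow> nat \<Rightarrow> 'a list set" where
  "lang F n = {w. length w = n \<and> allowed F w}"

definition irreducible_shift :: "'a list set \<Rightarrow> bool" where
  "irreducible_shift F \<longleftrightarrow>
     (\<forall>u v. allowed F u \<longrightarrow> allowed F v \<longrightarrow> (\<exists>w. allowed F (u @ w @ v)))"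

definition occ_count :: "'a list \<Rightarrow> 'a list \<Rightarrow> nat" where
  "occ_count w r = card {k. k + length r \<le> length w \<and> take (length r) (drop k w) = r}"

definition word_mult :: "'a list list \<Rightarrow> (nat \<Rightarrow> nat) \<Rightarrow> 'a list \<Rightarrow> nat" where
  "word_mult rep m w = (\<Prod>i<length rep. m i ^ occ_count w (rep ! i))"

text \<open>For words \<open>X\<close>, \<open>Y\<close> of length \<open>p - 1\<close>, the product \<open>X * Y\<close> is defined iff
  \<open>tl X = butlast Y\<close>, and it is then \<open>X @ [last Y]\<close>.\<close>

definition adj_entry ::
  "'a list list \<Rightarrow> 'a list list \<Rightarrow> (nat \<Rightarrow> nat) \<Rightarrow> nat \<Rightarrow> 'a list \<Rightarrow> 'a list \<Rightarrow> real" where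
  "adj_entry forb rep m p X Y =
     (if tl X = butlast Y \<and> X @ [last Y] \<in> lang (set forb) p
      then real (word_mult rep m (X @ [last Y])) else 0)"

text \<open>\<open>Ls\<close> is an enumeration of the words of length \<open>p - 1\<close> in the language; it fixes
  the order of rows and columns.\<close>

definition adj_mat_of ::
  "'a list list \<Rightarrow> 'a list list \<Rightarrow> (nat \<Rightarrow> nat) \<Rightarrow> nat \<Rightarrow> 'a list list \<Rightarrow> real mat" where
  "adj_mat_of forb rep m p Ls =
     mat (length Ls) (length Ls) (\<lambda>(i, j). adj_entry forb rep m p (Ls ! i) (Ls ! j))"

definition perron_root :: "real mat \<Rightarrow> real" where
  "perron_root A = spectral_radius (map_mat complex_of_real A)"

definition corr_coeff :: "'a list \<Rightarrow> 'a list \<Rightarrow> nat \<Rightarrow> bool" where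
  "corr_coeff u v i \<longleftrightarrow>
     (let k = min (length u - i) (length v) in take k (drop i u) = take k v)"

definition corr_poly :: "'a list \<Rightarrow> 'a list \<Rightarrow> real poly" where
  "corr_poly u v = (\<Sum>i<length u. monom (of_bool (corr_coeff u v i)) (length u - 1 - i))"

definition D_poly :: "'a list list \<Rightarrow> (nat \<Rightarrow> nat) \<Rightarrow> nat \<Rightarrow> real poly" where
  "D_poly rep m i = (if i < length rep then monom (1 - 1 / real (m i)) 1 else monom (-1) 1)"

text \<open>Rows and columns are indexed by the joint list \<open>rep @ forb\<close>: in every block of \<open>P\<close>
  the entry in position \<open>(i, j)\<close> contains the correlation of the \<open>j\<close>-th word with the
  \<open>i\<close>-th one.\<close>

definition P_entry :: "'a list list \<Rightarrow> 'a list list \<Rightarrow> (nat \<Rightarrow> nat) \<Rightarrow> nat \<Rightarrow> nat \<Rightarrow> real poly" where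
  "P_entry forb rep m i j =
     (let ws = rep @ forb in
      if j < length rep
      then monom (1 - 1 / real (m j)) 1 * corr_poly (ws ! j) (ws ! i)
           - (if i = j then monom 1 (length (rep ! j)) else 0)
      else - monom 1 1 * corr_poly (ws ! j) (ws ! i))"

definition P_mat :: "'a list list \<Rightarrow> 'a list list \<Rightarrow> (nat \<Rightarrow> nat) \<Rightarrow> real poly fract mat" where
  "P_mat forb rep m =
     (let n = length rep + length forb in
      mat n n (\<lambda>(i, j). to_fract (P_entry forb rep m i j)))"

definition D_mat :: "'a list list \<Rightarrow> 'a list list \<Rightarrow> (nat \<Rightarrow> nat) \<Rightarrow> real poly fract mat" where
  "D_mat forb rep m =
     (let n = length rep + length forb in
      mat n n (\<lambda>(i, j). if i = j then to_fract (D_poly rep m i) else 0))"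

definition mat_inv :: "'b :: field mat \<Rightarrow> 'b mat" where
  "mat_inv M = the (mat_inverse M)"

definition Q_mat :: "'a list list \<Rightarrow> 'a list list \<Rightarrow> (nat \<Rightarrow> nat) \<Rightarrow> real poly fract mat" where
  "Q_mat forb rep m =
     mat_inv (D_mat forb rep m) * transpose_mat (P_mat forb rep m) * D_mat forb rep m"

definition row_sum :: "'b :: comm_monoid_add mat \<Rightarrow> nat \<Rightarrow> 'b" where
  "row_sum M i = (\<Sum>j<dim_col M. M $$ (i, j))"

text \<open>The value of a rational function at a point is computed from its representation in
  lowest terms, so that removable singularities are removed before evaluation.\<close>

definition fract_value :: "real poly fract \<Rightarrow> real \<Rightarrow> real" where
  "fract_value f t = poly (fst (quot_of_fract f)) t / poly (snd (quot_of_fract f)) t"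

definition R_fun :: "'a list list \<Rightarrow> 'a list list \<Rightarrow> (nat \<Rightarrow> nat) \<Rightarrow> nat \<Rightarrow> real poly fract" where
  "R_fun forb rep m i = row_sum (mat_inv (P_mat forb rep m)) i"

definition S_fun :: "'a list list \<Rightarrow> 'a list list \<Rightarrow> (nat \<Rightarrow> nat) \<Rightarrow> nat \<Rightarrow> real poly fract" where
  "S_fun forb rep m i = row_sum (mat_inv (Q_mat forb rep m)) i"

definition U_entry ::
  "'a list list \<Rightarrow> 'a list list \<Rightarrow> (nat \<Rightarrow> nat) \<Rightarrow> real \<Rightarrow> 'a list \<Rightarrow> real" where
  "U_entry forb rep m \<theta> X =
     1 - \<theta> * (\<Sum>i<length rep. (1 - 1 / real (m i)) * fract_value (R_fun forb rep m i) \<theta>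
                 * poly (corr_poly (tl (rep ! i)) X) \<theta>)
       + \<theta> * (\<Sum>j<length forb. fract_value (R_fun forb rep m (length rep + j)) \<theta>
                 * poly (corr_poly (tl (forb ! j)) X) \<theta>)"

definition V_entry ::
  "'a list list \<Rightarrow> 'a list list \<Rightarrow> (nat \<Rightarrow> nat) \<Rightarrow> real \<Rightarrow> 'a list \<Rightarrow> real" where
  "V_entry forb rep m \<theta> X =
     1 - \<theta> * (\<Sum>i<length rep. (1 - 1 / real (m i)) * fract_value (S_fun forb rep m i) \<theta>
                 * poly (corr_poly X (rep ! i)) \<theta>)
       + \<theta> * (\<Sum>j<length forb. fract_value (S_fun forb rep m (length rep + j)) \<theta>
                 * poly (corr_poly X (forb ! j)) \<theta>)"

end

theory Submission
  imports Defs
begin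

text \<open>
  Let \<open>G(z)\<close> be the sum of \<open>m(w) z\<^sup>-\<^sup>n\<close> over all words \<open>w\<close> avoiding \<open>forb\<close>, where
  \<open>n = |w|\<close>, and \<open>y\<^sub>j(z)\<close> the analogous sum over the words that end with the \<open>j\<close>-th word of
  \<open>rep @ forb\<close> (for a forbidden word: whose only forbidden factor is that suffix, weighted as
  before its last letter was added). Appending a fixed word letter by letter and recording each
  change of weight turns into the linear system \<open>P y = -G 1\<close> when the fixed word is one of
  \<open>rep @ forb\<close>, so that the row sums \<open>R\<^sub>j\<close> of the inverse of \<open>P\<close> are \<open>-y\<^sub>j / G\<close>; when the fixed
  word is a state \<open>X\<close> it shows that \<open>U\<^sub>X\<close> is the limit of \<open>z\<^sup>p\<^sup>-\<^sup>1 G\<^sub>X(z) / G(z)\<close> as \<open>z\<close>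
  decreases to the Perron root, with \<open>G\<^sub>X\<close> the part of \<open>G\<close> coming from words ending with \<open>X\<close>.
  The quotients \<open>y\<^sub>j / G\<close> stay bounded, so \<open>R\<^sub>j\<close> has no pole at the Perron root. Since \<open>G\<close>
  diverges there, the recursion of \<open>G\<^sub>X\<close> under the adjacency matrix becomes the eigenvector
  equation in the limit. The right eigenvector is the same statement for reversed words, because
  \<open>Q\<close> is the matrix \<open>P\<close> of the reversed words.
\<close>

subsection \<open>Occurrences and sums over words\<close>

text \<open>The system cannot simply be solved at the Perron root: the series G diverges there, and
  a zero of det P is not excluded. All identities are proved for larger z and divided by G before
  the limit, which also erases finitely many initial terms of any recursion. This tolerance matters
  because the shift is one-sided. The matrix P closes up for words avoiding \<open>forb\<close>, and
  such a word need not be allowed. By compactness a word of length p - 1 that is not allowed has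
  only clean extensions of bounded length to the right; no such bound is available to the left.
  Recursions over the states are therefore exact for words ending with a state, but hold only from
  some length on for words beginning with one. Reversal is carried out before allowed words appear,
  where the setting is symmetric. The Perron root enters only through growth: G converges above the
  spectral radius and diverges at it, because an eigenvector of maximal modulus keeps the rescaled
  powers of A from tending to zero. That the spectral radius is itself an eigenvalue comes out of
  the limit.\<close>

text \<open>Factorizations behave better than positions: reversal swaps the two outer factors, and a
  new last letter either lengthens the right factor or creates one with empty right factor.\<close>

lemma card_occ: "occ_count w r = card {(u, v). w = u @ r @ v}"
proof -
  have "bij_betw (\<lambda>k. (take k w, drop (k + length r) w))
     {k. k + length r \<le> length w \<and> take (length r) (drop k w) = r} {(u, v). w = u @ r @ v}"
  proof (rule bij_betw_byWitness[where f' = "\<lambda>(u, v). length u"])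
    show "(\<lambda>k. (take k w, drop (k + length r) w)) `
      {k. k + length r \<le> length w \<and> take (length r) (drop k w) = r} \<subseteq> {(u, v). w = u @ r @ v}"
      by clarsimp (metis add.commute append_take_drop_id drop_drop)
  qed auto
  then show ?thesis
    unfolding occ_count_def by (rule bij_betw_same_card)
qed

lemma occ_count_rev: "occ_count (rev w) (rev r) = occ_count w r"
proof -
  have "bij_betw (\<lambda>(u, v). (rev v, rev u)) {(u, v). w = u @ r @ v} {(u, v). rev w = u @ rev r @ v}"
    by (rule bij_betw_byWitness[where f' = "\<lambda>(u, v). (rev v, rev u)"])
      (auto simp: rev_swap)
  then show ?thesis
    unfolding card_occ by (rule bij_betw_same_card[symmetric])
qed

lemma occ_count_snoc:
  assumes "r \<noteq> []"
  shows "occ_count (w @ [c]) r = occ_count w r + of_bool (suffix r (w @ [c]))"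
proof -
  let ?S = "{(u, v). w = u @ r @ v}"
  let ?T = "{(u, v). w @ [c] = u @ r @ v}"
  let ?S' = "(\<lambda>(u, v). (u, v @ [c])) ` ?S"
  let ?E = "{(u, v). w @ [c] = u @ r \<and> v = []}"
  have T: "?T = ?S' \<union> ?E"
  proof (intro Set.set_eqI, clarify)
    fix u v
    show "(u, v) \<in> ?T \<longleftrightarrow> (u, v) \<in> ?S' \<union> ?E"
      by (cases v rule: rev_cases) (use assms in \<open>auto simp: image_iff\<close>)
  qed
  have "finite ?S"
    by (rule finite_subset[of _ "set (prefixes w) \<times> set (suffixes w)"])
      (auto simp: prefix_def suffix_def)
  moreover have E: "?E = (if suffix r (w @ [c]) then {(take (Suc (length w) - length r) (w @ [c]), [])} else {})"
  proof (cases "suffix r (w @ [c])")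
    case True
    then obtain u where "w @ [c] = u @ r" by (auto simp: suffix_def simp del: suffix_snoc)
    moreover from this have "take (Suc (length w) - length r) (w @ [c]) = u"
      by (metis add_diff_cancel_right' append_eq_conv_conj length_append length_append_singleton)
    ultimately show ?thesis using True by (auto simp del: suffix_snoc)
  qed (auto simp: suffix_def simp del: suffix_snoc)
  moreover have "card ?S' = card ?S"
    by (intro card_image) (auto simp: inj_on_def)
  moreover have "?S' \<inter> ?E = {}" by auto
  ultimately show ?thesis
    unfolding card_occ T by (subst card_Un_disjoint) (auto simp del: suffix_snoc split: if_splits)
qed

lemma occ_count_short: "length w < length r \<Longrightarrow> occ_count w r = 0"
  by (auto simp: occ_count_def)

lemma word_mult_rev: "word_mult (map rev rep) m (rev w) = word_mult rep m w"
  by (simp add: word_mult_def occ_count_rev)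

lemma suffix_rev_iff: "suffix (rev u) (rev v) \<longleftrightarrow> prefix u v"
  by (simp add: suffix_to_prefix)

text \<open>Coefficient sequences of all series below: \<open>\<mu>\<close> gives G,
  \<open>\<eta> j\<close> gives y_j, and \<open>\<lambda>w. \<mu> (w @ X)\<close> the part of words
  ending with X. The last is indexed by the length of \<open>w\<close> alone, which absorbs the
  factor z^(p-1) of the overview.\<close>

definition word_sum :: "('a::finite list \<Rightarrow> real) \<Rightarrow> nat \<Rightarrow> real" where
  "word_sum \<phi> n = (\<Sum>w | length w = n. \<phi> w)"

lemma word_sum_suffix:
  assumes "\<And>y. \<not> suffix u y \<Longrightarrow> \<phi> y = 0"
  shows "word_sum (\<lambda>w. \<phi> (w @ u)) n = word_sum \<phi> (n + length u)"
proof -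
  have "word_sum \<phi> (n + length u) = sum \<phi> {y. length y = n + length u \<and> suffix u y}"
    unfolding word_sum_def using assms
    by (intro sum.mono_neutral_right) (auto intro: finite_subset[OF _ finite_list_length])
  also have "{y. length y = n + length u \<and> suffix u y} = (\<lambda>w. w @ u) ` {w. length w = n}"
    by (auto simp: suffix_def)
  also have "sum \<phi> \<dots> = word_sum (\<lambda>w. \<phi> (w @ u)) n"
    unfolding word_sum_def by (subst sum.reindex) (auto simp: inj_on_def)
  finally show ?thesis ..
qed

lemma word_sum_nonneg: "(\<And>w. \<phi> w \<ge> 0) \<Longrightarrow> word_sum \<phi> n \<ge> 0"
  unfolding word_sum_def by (intro sum_nonneg) auto

lemma word_sum_append_le:
  assumes "\<And>w. 0 \<le> \<phi> w"
  shows "word_sum (\<lambda>w. \<phi> (w @ v)) n \<le> word_sum \<phi> (n + length v)"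
proof -
  have "word_sum (\<lambda>w. \<phi> (w @ v)) n = sum \<phi> ((\<lambda>w. w @ v) ` {w. length w = n})"
    unfolding word_sum_def by (subst sum.reindex) (auto simp: inj_on_def)
  also have "\<dots> \<le> word_sum \<phi> (n + length v)"
    unfolding word_sum_def using assms by (intro sum_mono2 finite_list_length) auto
  finally show ?thesis .
qed

lemma word_sum_rev: "word_sum (\<lambda>w. \<phi> (rev w)) n = word_sum \<phi> n"
  unfolding word_sum_def by (rule sum.reindex_bij_witness[where i = rev and j = rev]) auto

lemma sum_lists_Suc_snoc:
  "(\<Sum>w | length w = Suc n. \<phi> w) = (\<Sum>c\<in>UNIV. \<Sum>w | length w = n. \<phi> (w @ [c :: 'a::finite]))"
proof -
  have "(\<Sum>c\<in>UNIV. \<Sum>w | length w = n. \<phi> (w @ [c])) = (\<Sum>(c, w)\<in>UNIV \<times> {w. length w = n}. \<phi> (w @ [c]))"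
    by (simp add: sum.cartesian_product)
  also have "\<dots> = (\<Sum>w | length w = Suc n. \<phi> w)"
    by (rule sum.reindex_bij_witness[where i = "\<lambda>w. (last w, butlast w)" and j = "\<lambda>(c, w). w @ [c]"])
      (auto simp: append_butlast_last_id simp flip: length_greater_0_conv)
  finally show ?thesis ..
qed

lemma sum_lists_add:
  "(\<Sum>w | length w = n + k. \<phi> w) = (\<Sum>v | length v = k. \<Sum>w | length w = n. \<phi> (w @ (v :: 'a::finite list)))"
proof -
  have "(\<Sum>v | length v = k. \<Sum>w | length w = n. \<phi> (w @ v))
      = (\<Sum>(v, w)\<in>{v. length v = k} \<times> {w. length w = n}. \<phi> (w @ v))"
    by (simp add: sum.cartesian_product)
  also have "\<dots> = (\<Sum>w | length w = n + k. \<phi> w)"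
    by (rule sum.reindex_bij_witness[where i = "\<lambda>w. (drop n w, take n w)" and j = "\<lambda>(v, w). w @ v"]) auto
  finally show ?thesis ..
qed

subsection \<open>Rational functions and inverse matrices\<close>

text \<open>The \<open>c i\<close> are bounds rather than degrees, so the coefficients at them may
  vanish. This allows all Leibniz terms of a determinant to be compared at one common
  degree.\<close>

lemma coeff_prod_sum:
  fixes f :: "'i \<Rightarrow> 'b::idom poly"
  assumes "finite I" "\<And>i. i \<in> I \<Longrightarrow> degree (f i) \<le> c i"
  shows "degree (\<Prod>i\<in>I. f i) \<le> (\<Sum>i\<in>I. c i) \<and>
    coeff (\<Prod>i\<in>I. f i) (\<Sum>i\<in>I. c i) = (\<Prod>i\<in>I. coeff (f i) (c i))"
  using assms
proof (induction I)
  case (insert x I)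
  let ?q = "\<Prod>i\<in>I. f i" and ?s = "\<Sum>i\<in>I. c i"
  have IH: "degree ?q \<le> ?s" "coeff ?q ?s = (\<Prod>i\<in>I. coeff (f i) (c i))" "degree (f x) \<le> c x"
    using insert by auto
  have "coeff (f x * ?q) (c x + ?s) = coeff (f x) (c x) * coeff ?q ?s"
  proof (cases "degree (f x) = c x \<and> degree ?q = ?s")
    case True
    then show ?thesis using coeff_mult_degree_sum[of "f x" ?q] by simp
  next
    case False
    then have "degree (f x) < c x \<or> degree ?q < ?s" using IH by linarith
    moreover from this have "degree (f x * ?q) < c x + ?s"
      using IH(1,3) degree_mult_le[of "f x" ?q] by linarith
    ultimately show ?thesis by (auto simp: coeff_eq_0)
  qed
  moreover have "degree (f x * ?q) \<le> c x + ?s"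
    using IH(1,3) degree_mult_le[of "f x" ?q] by linarith
  ultimately show ?case using insert.hyps IH by simp
qed simp

text \<open>In the Leibniz formula every term has degree at most the sum of the column bounds. At
  exactly that degree a permutation other than the identity picks an off-diagonal entry whose
  coefficient is zero, so only the product of the diagonal coefficients survives.\<close>

lemma det_nonzero_if_dominant_diagonal:
  fixes A :: "'b::idom poly mat"
  assumes A: "A \<in> carrier_mat n n"
    and deg: "\<And>i j. i < n \<Longrightarrow> j < n \<Longrightarrow> degree (A $$ (i, j)) \<le> c j"
    and off: "\<And>i j. i < n \<Longrightarrow> j < n \<Longrightarrow> i \<noteq> j \<Longrightarrow> coeff (A $$ (i, j)) (c j) = 0"
    and diag: "\<And>i. i < n \<Longrightarrow> coeff (A $$ (i, i)) (c i) \<noteq> 0"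
  shows "det A \<noteq> 0"
proof -
  let ?S = "\<Sum>i = 0..<n. c i"
  have summand: "coeff (of_int (sign \<pi>) * (\<Prod>i = 0..<n. A $$ (i, \<pi> i))) ?S
      = (if \<pi> = id then \<Prod>i = 0..<n. coeff (A $$ (i, i)) (c i) else 0)" if \<pi>: "\<pi> permutes {0..<n}" for \<pi>
  proof -
    have lt: "\<pi> i < n" if "i < n" for i using permutes_in_image[OF \<pi>, of i] that by simp
    have "(\<Sum>i = 0..<n. c (\<pi> i)) = ?S" using sum.permute[OF \<pi>, of c] by (simp add: comp_def)
    then have *: "coeff (\<Prod>i = 0..<n. A $$ (i, \<pi> i)) ?S = (\<Prod>i = 0..<n. coeff (A $$ (i, \<pi> i)) (c (\<pi> i)))"
      using coeff_prod_sum[of "{0..<n}" "\<lambda>i. A $$ (i, \<pi> i)" "\<lambda>i. c (\<pi> i)"] deg lt by simp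
    show ?thesis
    proof (cases "\<pi> = id")
      case True
      then show ?thesis using * by (simp add: sign_id)
    next
      case False
      then obtain i where "\<pi> i \<noteq> i" by fastforce
      then have "i < n" "coeff (A $$ (i, \<pi> i)) (c (\<pi> i)) = 0"
        using permutes_not_in[OF \<pi>, of i] off[of i "\<pi> i"] lt[of i] by auto
      then have "(\<Prod>i = 0..<n. coeff (A $$ (i, \<pi> i)) (c (\<pi> i))) = 0" by (intro prod_zero) auto
      then show ?thesis using * False by (cases \<pi> rule: sign_cases) auto
    qed
  qed
  have "coeff (det A) ?S = (\<Sum>\<pi> | \<pi> permutes {0..<n}. if \<pi> = id then \<Prod>i = 0..<n. coeff (A $$ (i, i)) (c i) else 0)"
    unfolding det_def'[OF A] coeff_sum using summand by (intro sum.cong) auto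
  also have "\<dots> = (\<Prod>i = 0..<n. coeff (A $$ (i, i)) (c i))"
    by (subst sum.delta) (auto simp: finite_permutations permutes_id)
  also have "\<dots> \<noteq> 0" using diag by simp
  finally show ?thesis by auto
qed

lemma eventually_poly_nonzero:
  fixes d :: "real poly"
  assumes "d \<noteq> 0"
  shows "eventually (\<lambda>z. poly d z \<noteq> 0) (at \<theta> within S)"
proof -
  have "eventually (\<lambda>z. \<forall>r\<in>{r. poly d r = 0}. z \<noteq> r) (at \<theta> within S)"
    using poly_roots_finite[OF assms] by (intro eventually_ball_finite) (auto intro: eventually_neq_at_within)
  then show ?thesis by (rule eventually_mono) blast
qed

text \<open>A bounded rational function has no pole, so its value in lowest terms is its limit.\<close>

lemma fract_value_tendsto:
  fixes f :: "real poly fract"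
  assumes d: "d \<noteq> 0" and Nd: "to_fract N = to_fract d * f"
    and bd: "eventually (\<lambda>z. \<bar>h z\<bar> \<le> B) (at_right \<theta>)"
    and ev: "eventually (\<lambda>z. poly N z = h z * poly d z) (at_right \<theta>)"
  shows "(h \<longlongrightarrow> fract_value f \<theta>) (at_right \<theta>)"
proof -
  define n0 d0 where "n0 = fst (quot_of_fract f)" and "d0 = snd (quot_of_fract f)"
  have d0: "d0 \<noteq> 0" and cop: "coprime n0 d0"
    unfolding n0_def d0_def by (simp_all add: coprime_quot_of_fract)
  have "f = to_fract n0 / to_fract d0"
    unfolding n0_def d0_def Fract_conv_to_fract[symmetric] by (rule Fract_quot_of_fract[symmetric])
  then have "to_fract (N * d0) = to_fract (d * n0)" using Nd d0 by simp
  then have eq: "N * d0 = d * n0" by (simp only: to_fract_eq_iff)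
  have ev0: "eventually (\<lambda>z. poly n0 z = h z * poly d0 z) (at_right \<theta>)"
    using ev eventually_poly_nonzero[OF d]
  proof eventually_elim
    case (elim z)
    have "poly N z * poly d0 z = poly d z * poly n0 z"
      using arg_cong[OF eq, of "\<lambda>q. poly q z"] by simp
    then show ?case using elim by simp
  qed
  have lim: "((\<lambda>z. poly q z) \<longlongrightarrow> poly q \<theta>) (at_right \<theta>)" for q :: "real poly"
    by (intro tendsto_intros)
  \<comment> \<open>A zero of the denominator would, since \<open>h\<close> is bounded, force a zero
    of the numerator at the same point, against coprimality.\<close>
  have "poly d0 \<theta> \<noteq> 0"
  proof
    assume z: "poly d0 \<theta> = 0"
    have "((\<lambda>z. poly d0 z * h z) \<longlongrightarrow> 0) (at_right \<theta>)"
    proof (rule tendsto_norm_zero_cancel, rule tendsto_sandwich[OF _ _ tendsto_const])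
      show "eventually (\<lambda>z. norm (poly d0 z * h z) \<le> \<bar>poly d0 z\<bar> * B) (at_right \<theta>)"
        using bd by eventually_elim (simp add: abs_mult mult_left_mono)
      show "eventually (\<lambda>z. 0 \<le> norm (poly d0 z * h z)) (at_right \<theta>)" by simp
      show "((\<lambda>z. \<bar>poly d0 z\<bar> * B) \<longlongrightarrow> 0) (at_right \<theta>)"
        using tendsto_mult_right[OF tendsto_rabs[OF lim[of d0]], of B] z by simp
    qed
    then have "((\<lambda>z. poly n0 z) \<longlongrightarrow> 0) (at_right \<theta>)"
      by (rule Lim_transform_eventually) (use ev0 in \<open>eventually_elim, simp add: mult.commute\<close>)
    then have "poly n0 \<theta> = 0" using lim[of n0] tendsto_unique by (metis trivial_limit_at_right_real)
    then have "[:-\<theta>, 1:] dvd n0" "[:-\<theta>, 1:] dvd d0" using z by (simp_all add: poly_eq_0_iff_dvd)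
    then have "is_unit [:-\<theta>, 1:]" using cop coprime_common_divisor by blast
    then show False by (simp add: is_unit_iff_degree)
  qed
  then have "((\<lambda>z. poly n0 z / poly d0 z) \<longlongrightarrow> poly n0 \<theta> / poly d0 \<theta>) (at_right \<theta>)"
    by (intro tendsto_divide lim)
  moreover have "eventually (\<lambda>z. poly n0 z / poly d0 z = h z) (at_right \<theta>)"
    using ev0 eventually_poly_nonzero[OF d0] by eventually_elim simp
  ultimately show ?thesis
    unfolding fract_value_def n0_def[symmetric] d0_def[symmetric] by (rule Lim_transform_eventually)
qed

section \<open>Inverses over the fraction field and adjugates over the polynomials\<close>

lemma mat_inv_eqI:
  fixes M :: "'b::field mat"
  assumes M: "M \<in> carrier_mat n n" and B: "B \<in> carrier_mat n n" and MB: "M * B = 1\<^sub>m n"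
  shows "mat_inv M = B"
proof -
  have BM: "B * M = 1\<^sub>m n" using mat_mult_left_right_inverse[OF M B MB] .
  have "M \<in> Units (ring_mat TYPE('b) n b)" for b :: unit
    unfolding Units_def ring_mat_def using M B MB BM by auto
  then obtain C where C: "mat_inverse M = Some C"
    using mat_inverse(1)[OF M, where b = "()"] by (cases "mat_inverse M") auto
  then have "C * M = 1\<^sub>m n" "C \<in> carrier_mat n n" using mat_inverse(2)[OF M] by auto
  then have "C * (M * B) = 1\<^sub>m n * B"
    using assoc_mult_mat[OF _ M B, of C n] by simp
  then have "C = B" using MB B \<open>C \<in> carrier_mat n n\<close> by simp
  then show ?thesis by (simp add: mat_inv_def C)
qed

lemma ring_hom_to_fract: "comm_ring_hom (to_fract :: 'b::idom \<Rightarrow> 'b fract)"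
  by unfold_locales auto

text \<open>The inverse is the adjugate divided by the determinant, which exhibits the row sum as a
  quotient of two polynomials that can be evaluated. Here \<open>adj_mat\<close> is the adjugate,
  not an adjacency matrix.\<close>

lemma row_sum_mat_inv_to_fract:
  fixes A :: "'b::idom mat"
  assumes A: "A \<in> carrier_mat n n" and d: "det A \<noteq> 0" and i: "i < n"
  shows "to_fract (row_sum (adj_mat A) i) = to_fract (det A) * row_sum (mat_inv (map_mat to_fract A)) i"
proof -
  interpret comm_ring_hom "to_fract :: 'b \<Rightarrow> 'b fract" by (rule ring_hom_to_fract)
  let ?F = "map_mat to_fract A" and ?B = "inverse (to_fract (det A)) \<cdot>\<^sub>m map_mat to_fract (adj_mat A)"
  have adj: "adj_mat A \<in> carrier_mat n n" "A * adj_mat A = det A \<cdot>\<^sub>m 1\<^sub>m n" using adj_mat[OF A] by auto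
  have "?F * map_mat to_fract (adj_mat A) = map_mat to_fract (det A \<cdot>\<^sub>m 1\<^sub>m n)"
    using mat_hom_mult[OF A adj(1)] adj(2) by simp
  then have "?F * ?B = inverse (to_fract (det A)) \<cdot>\<^sub>m map_mat to_fract (det A \<cdot>\<^sub>m 1\<^sub>m n)"
    using A adj(1) by (subst mult_smult_distrib[of _ n n _ n]) auto
  also have "\<dots> = 1\<^sub>m n" using d by (intro eq_matI) auto
  finally have "mat_inv ?F = ?B" using A adj(1) by (intro mat_inv_eqI[of _ n]) auto
  then show ?thesis using adj(1) d i
    by (simp add: row_sum_def to_fract_sum sum_distrib_left flip: mult.assoc)
qed

text \<open>Cramer's rule identifies the row sums of the inverse with the solutions of
  \<open>A y = 1\<close>.\<close>

lemma row_sum_inverse_tendsto: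
  fixes A :: "real poly mat"
  assumes A: "A \<in> carrier_mat n n" and d: "det A \<noteq> 0" and i: "i < n"
    and eq: "eventually (\<lambda>z. \<forall>i<n. (\<Sum>j<n. poly (A $$ (i, j)) z * y j z) = 1) (at_right \<theta>)"
    and bd: "eventually (\<lambda>z. \<bar>y i z\<bar> \<le> B) (at_right \<theta>)"
  shows "(y i \<longlongrightarrow> fract_value (row_sum (mat_inv (map_mat to_fract A)) i) \<theta>) (at_right \<theta>)"
proof (rule fract_value_tendsto[OF d row_sum_mat_inv_to_fract[OF A d i] bd])
  have adj: "adj_mat A \<in> carrier_mat n n" "adj_mat A * A = det A \<cdot>\<^sub>m 1\<^sub>m n" using adj_mat[OF A] by auto
  have ent: "(\<Sum>k<n. adj_mat A $$ (i, k) * A $$ (k, j)) = (if i = j then det A else 0)" if "j < n" for j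
    using arg_cong[OF adj(2), of "\<lambda>M. M $$ (i, j)"] A adj(1) i that
    by (simp add: scalar_prod_def lessThan_atLeast0)
  show "eventually (\<lambda>z. poly (row_sum (adj_mat A) i) z = y i z * poly (det A) z) (at_right \<theta>)"
    using eq
  proof eventually_elim
    case (elim z)
    have "poly (row_sum (adj_mat A) i) z
        = (\<Sum>k<n. poly (adj_mat A $$ (i, k)) z * (\<Sum>j<n. poly (A $$ (k, j)) z * y j z))"
      using elim adj(1) by (simp add: row_sum_def poly_sum)
    also have "\<dots> = (\<Sum>j<n. poly (\<Sum>k<n. adj_mat A $$ (i, k) * A $$ (k, j)) z * y j z)"
      unfolding poly_sum poly_mult sum_distrib_left sum_distrib_right mult.assoc by (rule sum.swap)
    also have "\<dots> = (\<Sum>j<n. if i = j then poly (det A) z * y j z else 0)"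
      by (intro sum.cong) (simp_all add: ent)
    also have "\<dots> = y i z * poly (det A) z" using i by (simp add: mult.commute)
    finally show ?case .
  qed
qed

lemma mat_inv_diagonal:
  fixes d :: "nat \<Rightarrow> 'b::field"
  assumes "\<And>i. i < n \<Longrightarrow> d i \<noteq> 0"
  shows "mat_inv (mat n n (\<lambda>(i, j). if i = j then d i else 0)) = mat n n (\<lambda>(i, j). if i = j then inverse (d i) else 0)"
proof (rule mat_inv_eqI)
  show "mat n n (\<lambda>(i, j). if i = j then d i else 0) * mat n n (\<lambda>(i, j). if i = j then inverse (d i) else 0) = 1\<^sub>m n"
  proof (rule eq_matI)
    fix i j assume ij: "i < dim_row (1\<^sub>m n :: 'b mat)" "j < dim_col (1\<^sub>m n :: 'b mat)"
    have "(mat n n (\<lambda>(i, j). if i = j then d i else 0) * mat n n (\<lambda>(i, j). if i = j then inverse (d i) else 0)) $$ (i, j)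
      = (\<Sum>k = 0..<n. (if i = k then d i else 0) * (if k = j then inverse (d k) else 0))"
      using ij by (simp add: scalar_prod_def)
    also have "\<dots> = (\<Sum>k = 0..<n. if k = i then (if i = j then 1 else 0) else 0)"
      using ij assms by (intro sum.cong) auto
    also have "\<dots> = 1\<^sub>m n $$ (i, j)" using ij by simp
    finally show "(mat n n (\<lambda>(i, j). if i = j then d i else 0) * mat n n (\<lambda>(i, j). if i = j then inverse (d i) else 0)) $$ (i, j)
      = 1\<^sub>m n $$ (i, j)" .
  qed auto
qed auto

subsection \<open>Power series in the reciprocal variable\<close>

definition gser :: "(nat \<Rightarrow> real) \<Rightarrow> real \<Rightarrow> real" where
  "gser a z = (\<Sum>n. a n / z ^ n)"

lemma summable_gser_shift:
  fixes z :: real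
  assumes "z \<noteq> 0"
  shows "summable (\<lambda>n. a (n + t) / z ^ n) \<longleftrightarrow> summable (\<lambda>n. a n / z ^ n)"
proof -
  have "(\<lambda>n. a (n + t) / z ^ (n + t)) = (\<lambda>n. inverse (z ^ t) * (a (n + t) / z ^ n))"
    using assms by (simp add: power_add field_simps)
  then have "summable (\<lambda>n. a (n + t) / z ^ (n + t)) \<longleftrightarrow> summable (\<lambda>n. a (n + t) / z ^ n)"
    using assms by (simp only: summable_cmult_iff) simp
  then show ?thesis using summable_iff_shift[of "\<lambda>n. a n / z ^ n" t] by simp
qed

text \<open>The correction is a finite sum. It vanishes for sequences that start late enough, and
  becomes negligible after division by a series tending to infinity; both cases occur below.\<close>

lemma gser_shift:
  fixes z :: real
  assumes "z \<noteq> 0" "summable (\<lambda>n. a n / z ^ n)"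
  shows "gser (\<lambda>n. a (n + t)) z = z ^ t * (gser a z - (\<Sum>i<t. a i / z ^ i))"
proof -
  have "gser (\<lambda>n. a (n + t)) z = (\<Sum>n. z ^ t * (a (n + t) / z ^ (n + t)))"
    unfolding gser_def using assms(1) by (intro arg_cong[of _ _ suminf]) (simp add: power_add field_simps)
  also have "\<dots> = z ^ t * (\<Sum>n. a (n + t) / z ^ (n + t))"
    using assms by (intro suminf_mult summable_ignore_initial_segment)
  also have "\<dots> = z ^ t * (gser a z - (\<Sum>i<t. a i / z ^ i))"
    unfolding gser_def using suminf_minus_initial_segment[OF assms(2), of t] by simp
  finally show ?thesis .
qed

lemma gser_mono:
  fixes z :: real
  assumes "z > 0" "summable (\<lambda>n. a n / z ^ n)" "summable (\<lambda>n. b n / z ^ n)" "\<And>n. a n \<le> b n"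
  shows "gser a z \<le> gser b z"
  unfolding gser_def using assms by (intro suminf_le) (auto intro: divide_right_mono)

lemma gser_nonneg: "z > 0 \<Longrightarrow> summable (\<lambda>n. a n / z ^ n) \<Longrightarrow> (\<And>n. a n \<ge> 0) \<Longrightarrow> gser a z \<ge> 0"
  unfolding gser_def by (intro suminf_nonneg) auto

lemma summable_gser_comparison:
  fixes z :: real
  assumes "z > 0" "summable (\<lambda>n. b n / z ^ n)" "\<And>n. 0 \<le> a n" "\<And>n. a n \<le> b n"
  shows "summable (\<lambda>n. a n / z ^ n)"
  using assms(2) by (rule summable_comparison_test'[where N = 0])
    (use assms in \<open>auto intro!: divide_right_mono\<close>)

text \<open>At the boundary some partial sum exceeds the given bound. By continuity it still does so
  slightly to the right, where nonnegativity makes it a lower bound of the whole series.\<close>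

lemma gser_at_top:
  assumes \<theta>: "\<theta> > 0" and nn: "\<And>n. a n \<ge> 0"
    and sm: "\<And>z. z > \<theta> \<Longrightarrow> summable (\<lambda>n. a n / z ^ n)"
    and ns: "\<not> summable (\<lambda>n. a n / \<theta> ^ n)"
  shows "filterlim (gser a) at_top (at_right \<theta>)"
  unfolding filterlim_at_top
proof
  fix B :: real
  have "\<exists>N. (\<Sum>n<N. a n / \<theta> ^ n) > B"
  proof (rule ccontr)
    assume "\<not> (\<exists>N. (\<Sum>n<N. a n / \<theta> ^ n) > B)"
    then have "summable (\<lambda>n. a n / \<theta> ^ n)"
      using nn \<theta> by (intro summableI_nonneg_bounded[where x = B]) (auto simp: not_less)
    then show False using ns by simp
  qed
  then obtain N where N: "(\<Sum>n<N. a n / \<theta> ^ n) > B" by blast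
  have "((\<lambda>z. \<Sum>n<N. a n / z ^ n) \<longlongrightarrow> (\<Sum>n<N. a n / \<theta> ^ n)) (at_right \<theta>)"
    using \<theta> by (intro tendsto_intros) auto
  then have "eventually (\<lambda>z. (\<Sum>n<N. a n / z ^ n) > B) (at_right \<theta>)"
    using N by (rule order_tendstoD(1))
  moreover have "eventually (\<lambda>z. z > \<theta>) (at_right \<theta>)" by (simp add: eventually_at_right_less)
  ultimately show "eventually (\<lambda>z. B \<le> gser a z) (at_right \<theta>)"
  proof eventually_elim
    case (elim z)
    have "(\<Sum>n<N. a n / z ^ n) \<le> gser a z"
      unfolding gser_def using elim \<theta> nn by (intro sum_le_suminf sm) auto
    then show ?case using elim by simp
  qed
qed
lemma gser_sum:
  assumes "\<And>i. i \<in> I \<Longrightarrow> summable (\<lambda>n. a i n / z ^ n)"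
  shows "gser (\<lambda>n. \<Sum>i\<in>I. c i * a i n) z = (\<Sum>i\<in>I. c i * gser (a i) z)"
proof -
  have "(\<lambda>n. \<Sum>i\<in>I. c i * (a i n / z ^ n)) sums (\<Sum>i\<in>I. c i * gser (a i) z)"
    unfolding gser_def using assms by (intro sums_sum sums_mult summable_sums)
  then show ?thesis by (simp add: gser_def sums_iff sum_divide_distrib)
qed

subsection \<open>Correlation polynomials\<close>

text \<open>The summation index is the length t of the overlap, that is, offset
  \<open>length e - t\<close>; the factor \<open>z\<close> makes the exponent equal to it. The
  hypothesis excludes offsets at which \<open>v\<close> ends strictly inside \<open>e\<close>: there
  the correlation records an occurrence of \<open>v\<close>, not an overlap of a suffix with a
  prefix.\<close>

lemma corr_poly_eval:
  assumes nf: "\<not> (sublist v e \<and> length v < length e)"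
  shows "z * poly (corr_poly e v) z = (\<Sum>t = 1..length v. if suffix (take t v) e then z ^ t else 0)"
proof -
  let ?f = "\<lambda>t. if t \<le> length v \<and> suffix (take t v) e then z ^ t else 0"
  have cc: "corr_coeff e v (length e - t) \<longleftrightarrow> t \<le> length v \<and> suffix (take t v) e" if t: "1 \<le> t" "t \<le> length e" for t
  proof (cases "t \<le> length v")
    case True
    have "suffix (take t v) e \<longleftrightarrow> drop (length e - t) e = take t v"
    proof
      assume "suffix (take t v) e"
      then obtain u where "e = u @ take t v" by (auto simp: suffix_def)
      then show "drop (length e - t) e = take t v" using True by (simp add: min_absorb2)
    qed (metis suffix_drop)
    then show ?thesis using True t by (simp add: corr_coeff_def min_absorb1)
  next
    case False
    have "\<not> corr_coeff e v (length e - t)"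
    proof
      assume "corr_coeff e v (length e - t)"
      then have "take (length v) (drop (length e - t) e) = v"
        using False t by (simp add: corr_coeff_def min_absorb2)
      then have "sublist v e" by (metis sublist_take sublist_drop sublist_order.order_trans)
      then show False using nf False t by simp
    qed
    then show ?thesis using False by simp
  qed
  have "z * poly (corr_poly e v) z = (\<Sum>i<length e. of_bool (corr_coeff e v i) * z ^ (length e - i))"
    unfolding corr_poly_def poly_sum poly_monom sum_distrib_left
  proof (intro sum.cong refl)
    fix i assume "i \<in> {..<length e}"
    then have "length e - i = Suc (length e - 1 - i)" by auto
    then show "z * (of_bool (corr_coeff e v i) * z ^ (length e - 1 - i)) = of_bool (corr_coeff e v i) * z ^ (length e - i)"
      by simp
  qed
  also have "\<dots> = (\<Sum>t = 1..length e. of_bool (corr_coeff e v (length e - t)) * z ^ t)"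
    by (rule sum.reindex_bij_witness[where i = "\<lambda>t. length e - t" and j = "\<lambda>i. length e - i"]) auto
  also have "\<dots> = (\<Sum>t = 1..length e. ?f t)"
    by (intro sum.cong) (auto simp: cc)
  also have "\<dots> = (\<Sum>t \<in> {1..length e} \<inter> {1..length v}. ?f t)"
    by (intro sum.mono_neutral_right) auto
  also have "\<dots> = (\<Sum>t = 1..length v. ?f t)"
    by (intro sum.mono_neutral_left) (auto dest!: suffix_length_le simp: min_absorb2)
  also have "\<dots> = (\<Sum>t = 1..length v. if suffix (take t v) e then z ^ t else 0)"
    by (intro sum.cong) auto
  finally show ?thesis .
qed

lemma degree_corr_poly: "degree (corr_poly u v) \<le> length u - 1"
  unfolding corr_poly_def by (intro degree_sum_le) (auto intro: order.trans[OF degree_monom_le])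

lemma coeff_corr_poly: "u \<noteq> [] \<Longrightarrow> coeff (corr_poly u v) (length u - 1) = of_bool (corr_coeff u v 0)"
proof -
  assume u: "u \<noteq> []"
  have "coeff (corr_poly u v) (length u - 1)
      = (\<Sum>i<length u. if i = 0 then of_bool (corr_coeff u v 0) else 0)"
    unfolding corr_poly_def coeff_sum using u by (intro sum.cong) auto
  also have "\<dots> = of_bool (corr_coeff u v 0)" using u by simp
  finally show ?thesis .
qed

lemma coeff_monom_1_mult:
  "k > 0 \<Longrightarrow> coeff (monom c 1 * q) k = c * coeff q (k - 1)" for q :: "real poly"
  by (cases k) (simp_all add: coeff_monom_mult)

lemma corr_coeff_0: "corr_coeff u v 0 \<longleftrightarrow> prefix u v \<or> prefix v u"
  unfolding corr_coeff_def Let_def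
  by (auto simp: min_def prefix_def split: if_splits) (metis append_take_drop_id)+

text \<open>An overlap is a suffix of \<open>u\<close> that is a prefix of \<open>v\<close>; read
  backwards it is a suffix of \<open>rev v\<close> and a prefix of \<open>rev u\<close>. The
  different ranges do no harm, since an overlap is no longer than either word.\<close>

lemma corr_sum_rev:
  "(\<Sum>t = 1..length v. if suffix (take t v) u then z ^ t else 0) =
   (\<Sum>t = 1..length u. if suffix (take t (rev u)) (rev v) then z ^ t else (0::real))"
proof -
  have eq: "suffix (take t v) u \<longleftrightarrow> suffix (take t (rev u)) (rev v)" if t: "t \<le> length u" "t \<le> length v" for t
  proof -
    have "suffix (take t v) u \<longleftrightarrow> drop (length u - t) u = take t v"
    proof
      assume "suffix (take t v) u"
      then obtain x where "u = x @ take t v" by (auto simp: suffix_def)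
      then show "drop (length u - t) u = take t v" using t by (simp add: min_absorb2)
    qed (metis suffix_drop)
    also have "\<dots> \<longleftrightarrow> prefix (drop (length u - t) u) v"
    proof
      assume "prefix (drop (length u - t) u) v"
      then obtain x where "v = drop (length u - t) u @ x" by (auto simp: prefix_def)
      then show "drop (length u - t) u = take t v" using t by (metis append_eq_conv_conj diff_diff_cancel length_drop)
    qed (metis take_is_prefix)
    also have "\<dots> \<longleftrightarrow> suffix (take t (rev u)) (rev v)"
      by (simp add: take_rev suffix_rev_iff)
    finally show ?thesis .
  qed
  have "(\<Sum>t = 1..length v. if suffix (take t v) u then z ^ t else 0)
      = (\<Sum>t \<in> {1..length u} \<inter> {1..length v}. if suffix (take t v) u then z ^ t else 0)"
    by (intro sum.mono_neutral_right) (auto dest!: suffix_length_le simp: min_absorb2)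
  also have "\<dots> = (\<Sum>t \<in> {1..length u} \<inter> {1..length v}. if suffix (take t (rev u)) (rev v) then z ^ t else 0)"
    by (intro sum.cong) (auto simp: eq)
  also have "\<dots> = (\<Sum>t = 1..length u. if suffix (take t (rev u)) (rev v) then z ^ t else 0)"
    by (intro sum.mono_neutral_left) (auto dest!: suffix_length_le simp: min_absorb2)
  finally show ?thesis .
qed

lemma corr_poly_rev:
  assumes "\<not> (sublist v u \<and> length v < length u)" "\<not> (sublist u v \<and> length u < length v)"
  shows "corr_poly (rev v) (rev u) = corr_poly u v"
proof -
  have "z * poly (corr_poly (rev v) (rev u)) z = z * poly (corr_poly u v) z" for z
    using corr_poly_eval[OF assms(1)] corr_poly_eval[of "rev u" "rev v"] assms(2) corr_sum_rev[where z = z and v = v and u = u]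
    by simp
  \<comment> \<open>The factor \<open>z\<close> is cancelled as a polynomial, because dividing the
    values by it would leave out the point 0.\<close>
  then have "poly (monom 1 1 * corr_poly (rev v) (rev u)) = poly (monom 1 1 * corr_poly u v)"
    by (intro ext) (simp add: poly_monom)
  then have "monom 1 1 * corr_poly (rev v) (rev u) = monom 1 1 * corr_poly u v"
    by (simp only: poly_eq_poly_eq_iff)
  then show ?thesis by (simp del: One_nat_def add: monom_eq_0_iff)
qed

subsection \<open>Weighted words\<close>

text \<open>All assumptions are invariant under reversing every word, unlike allowedness in a
  one-sided shift. This symmetry reduces the right eigenvector to the left one. Reducedness is
  required of \<open>rep\<close> and \<open>forb\<close> jointly, so that events of both kinds are
  treated alike.\<close>

locale weighted_words =
  fixes forb rep :: "'a::finite list list" and m :: "nat \<Rightarrow> nat" and p :: nat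
  assumes two_le_p: "2 \<le> p"
    and length_rep: "r \<in> set rep \<Longrightarrow> length r = p"
    and length_forb: "a \<in> set forb \<Longrightarrow> 2 \<le> length a \<and> length a \<le> p"
    and distinct_ev: "distinct (rep @ forb)"
    and reduced_ev: "u \<in> set (rep @ forb) \<Longrightarrow> v \<in> set (rep @ forb) \<Longrightarrow> sublist u v \<Longrightarrow> u = v"
    and two_le_m: "i < length rep \<Longrightarrow> 2 \<le> m i"
begin

abbreviation ev :: "nat \<Rightarrow> 'a list" where "ev j \<equiv> (rep @ forb) ! j"

definition nev :: nat where "nev = length rep + length forb"

definition clean :: "'a list \<Rightarrow> bool" where
  "clean w \<longleftrightarrow> (\<forall>a\<in>set forb. \<not> sublist a w)"

definition \<mu> :: "'a list \<Rightarrow> real" where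
  "\<mu> w = (if clean w then real (word_mult rep m w) else 0)"

text \<open>Completing the \<open>j\<close>-th word of \<open>rep @ forb\<close> changes the weight by \<open>\<delta> j * \<eta> j y\<close>, where \<open>y\<close> is the
  word after the change; see \<open>\<mu>_snoc\<close>. The diagonal of \<open>D\<close> is \<open>z * \<delta> j\<close>.\<close>

definition \<delta> :: "nat \<Rightarrow> real" where
  "\<delta> j = (if j < length rep then 1 - 1 / real (m j) else -1)"

definition \<eta> :: "nat \<Rightarrow> 'a list \<Rightarrow> real" where
  "\<eta> j y = (if suffix (ev j) y then if j < length rep then \<mu> y else \<mu> (butlast y) else 0)"

lemma ev_in: "j < nev \<Longrightarrow> ev j \<in> set (rep @ forb)"
  unfolding nev_def by (metis length_append nth_mem)

lemma ev_rep: "j < length rep \<Longrightarrow> ev j = rep ! j" "j < length rep \<Longrightarrow> rep ! j \<in> set rep"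
  by (auto simp: nth_append)

lemma ev_forb: "length rep \<le> j \<Longrightarrow> j < nev \<Longrightarrow> ev j \<in> set forb"
  by (auto simp: nth_append nev_def)

lemma ev_inj: "i < nev \<Longrightarrow> j < nev \<Longrightarrow> ev i = ev j \<longleftrightarrow> i = j"
  using nth_eq_iff_index_eq[OF distinct_ev, of i j] by (simp add: nev_def)

lemma length_ev: "j < nev \<Longrightarrow> 2 \<le> length (ev j) \<and> length (ev j) \<le> p"
  using ev_in[of j] length_rep length_forb two_le_p by (metis UnE order_refl set_append)

text \<open>Two suffixes of one word are comparable, and joint reducedness makes comparable words
  equal. Hence each new letter completes at most one word of \<open>rep @ forb\<close>.\<close>

lemma suffix_ev_unique:
  assumes "i < nev" "j < nev" "suffix (ev i) w" "suffix (ev j) w"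
  shows "i = j"
  using suffix_same_cases[OF assms(3,4)] reduced_ev ev_in assms(1,2) ev_inj suffix_imp_sublist by metis

lemma clean_sublist: "clean w \<Longrightarrow> sublist v w \<Longrightarrow> clean v"
  unfolding clean_def using sublist_order.order_trans by blast

lemma clean_snoc: "clean (w @ [c]) \<longleftrightarrow> clean w \<and> (\<forall>a\<in>set forb. \<not> suffix a (w @ [c]))"
  unfolding clean_def by (auto simp: sublist_snoc simp del: suffix_snoc)

lemma clean_Nil: "clean []"
  using length_forb by (fastforce simp: clean_def)

lemma word_mult_snoc:
  "word_mult rep m (w @ [c]) = word_mult rep m w * (\<Prod>i<length rep. if suffix (rep ! i) (w @ [c]) then m i else 1)"
proof -
  have "rep ! i \<noteq> []" if "i < length rep" for i
    using length_rep[of "rep ! i"] two_le_p that by auto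
  then show ?thesis
    by (auto simp: word_mult_def occ_count_snoc power_add simp flip: prod.distrib simp del: suffix_snoc
        intro!: prod.cong)
qed

lemma \<mu>_nonneg: "\<mu> w \<ge> 0" by (simp add: \<mu>_def)

lemma \<eta>_nonneg: "\<eta> j w \<ge> 0" by (simp add: \<eta>_def \<mu>_nonneg)

lemma word_mult_short: "length w < p \<Longrightarrow> word_mult rep m w = 1"
  unfolding word_mult_def by (intro prod.neutral) (auto simp: occ_count_short length_rep)

lemma \<mu>_Nil: "\<mu> [] = 1"
  using clean_Nil two_le_p by (simp add: \<mu>_def word_mult_short)

lemma word_mult_pos: "word_mult rep m w \<ge> 1"
proof -
  have "m i \<ge> 1" if "i < length rep" for i using two_le_m[OF that] by simp
  then show ?thesis unfolding word_mult_def by (simp add: Suc_le_eq prod_pos)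
qed

text \<open>At most one summand is nonzero. Completing a repeated word multiplies the weight by
  \<open>m j\<close>, so the gain is the fraction \<open>1 - 1 / m j\<close> of the new weight;
  completing a forbidden word loses the whole old weight. This explains the two cases of
  \<open>\<eta>\<close>.\<close>

lemma \<mu>_snoc: "\<mu> (w @ [c]) = \<mu> w + (\<Sum>j<nev. \<delta> j * \<eta> j (w @ [c]))"
proof (cases "\<exists>j<nev. suffix (ev j) (w @ [c])")
  case False
  then have r: "\<not> suffix (rep ! i) (w @ [c])" if "i < length rep" for i
    using that by (metis ev_rep(1) nev_def trans_less_add1)
  have "\<not> suffix a (w @ [c])" if a: "a \<in> set forb" for a
  proof -
    obtain i where "i < length forb" "a = forb ! i" using a by (auto simp: in_set_conv_nth)
    then have "ev (length rep + i) = a" "length rep + i < nev" by (auto simp: nev_def)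
    then show ?thesis using False by blast
  qed
  then have "clean (w @ [c]) = clean w" by (simp add: clean_snoc del: suffix_snoc)
  moreover have "word_mult rep m (w @ [c]) = word_mult rep m w"
    unfolding word_mult_snoc using r by (simp del: suffix_snoc)
  moreover have "\<eta> j (w @ [c]) = 0" if "j < nev" for j
    using False that unfolding \<eta>_def by presburger
  ultimately show ?thesis by (simp add: \<mu>_def)
next
  case True
  then obtain j where j: "j < nev" "suffix (ev j) (w @ [c])" by blast
  have "\<eta> i (w @ [c]) = 0" if "i < nev" "i \<noteq> j" for i
    using suffix_ev_unique[OF that(1) j(1) _ j(2)] that(2) unfolding \<eta>_def by argo
  then have "(\<Sum>i<nev. \<delta> i * \<eta> i (w @ [c])) = (\<Sum>i<nev. if i = j then \<delta> j * \<eta> j (w @ [c]) else 0)"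
    by (intro sum.cong) auto
  then have sum: "(\<Sum>i<nev. \<delta> i * \<eta> i (w @ [c])) = \<delta> j * \<eta> j (w @ [c])" using j(1) by simp
  show ?thesis
  proof (cases "j < length rep")
    case True
    have uniq: "suffix (rep ! i) (w @ [c]) \<longleftrightarrow> i = j" if "i < length rep" for i
      using suffix_ev_unique[of i j "w @ [c]"] j True that ev_rep(1) nev_def
      by (metis trans_less_add1)
    have "\<not> suffix a (w @ [c])" if a: "a \<in> set forb" for a
    proof
      assume sa: "suffix a (w @ [c])"
      obtain i where "i < length forb" "a = forb ! i" using a by (auto simp: in_set_conv_nth)
      then have i: "ev (length rep + i) = a" "length rep + i < nev" by (auto simp: nev_def)
      then have "length rep + i = j" using suffix_ev_unique[OF i(2) j(1) _ j(2)] sa by metis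
      then show False using True by simp
    qed
    then have cl: "clean (w @ [c]) = clean w" by (simp add: clean_snoc del: suffix_snoc)
    have "(\<Prod>i<length rep. if suffix (rep ! i) (w @ [c]) then m i else 1)
        = (\<Prod>i<length rep. if i = j then m j else 1)"
      by (intro prod.cong) (auto simp: uniq simp del: suffix_snoc)
    then have "word_mult rep m (w @ [c]) = word_mult rep m w * m j"
      unfolding word_mult_snoc using True by simp
    then have "\<mu> (w @ [c]) = m j * \<mu> w" by (simp add: \<mu>_def cl)
    moreover have "\<eta> j (w @ [c]) = \<mu> (w @ [c])" using j True by (simp add: \<eta>_def del: suffix_snoc)
    ultimately show ?thesis unfolding sum using True two_le_m[OF True]
      by (simp add: \<delta>_def field_simps)
  next
    case False
    then have "\<not> clean (w @ [c])" using ev_forb[of j] j by (auto simp: clean_snoc simp del: suffix_snoc)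
    then have "\<mu> (w @ [c]) = 0" by (simp add: \<mu>_def)
    moreover have "\<eta> j (w @ [c]) = \<mu> w" using j False by (simp add: \<eta>_def del: suffix_snoc)
    ultimately show ?thesis unfolding sum using False by (simp add: \<delta>_def)
  qed
qed

lemma \<mu>_append:
  "\<mu> (w @ v) = \<mu> w + (\<Sum>t = 1..length v. \<Sum>j<nev. \<delta> j * \<eta> j (w @ take t v))"
proof (induction v rule: rev_induct)
  case (snoc c v)
  have "(\<Sum>t = 1..length v. \<Sum>j<nev. \<delta> j * \<eta> j (w @ take t (v @ [c])))
      = (\<Sum>t = 1..length v. \<Sum>j<nev. \<delta> j * \<eta> j (w @ take t v))"
    by (intro sum.cong) auto
  then show ?case using snoc \<mu>_snoc[of "w @ v" c] by simp
qed simp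

text \<open>If \<open>ev j\<close> ends where \<open>w @ u\<close> ends, then \<open>u\<close> and
  \<open>ev j\<close> are comparable suffixes. The hypothesis rules out that \<open>ev j\<close> is
  the shorter one, so the condition on \<open>u\<close> no longer involves \<open>w\<close>.\<close>

lemma word_sum_\<eta>_append:
  assumes j: "j < nev" and nf: "\<not> (sublist (ev j) u \<and> length (ev j) < length u)"
  shows "word_sum (\<lambda>w. \<eta> j (w @ u)) n = (if suffix u (ev j) then word_sum (\<eta> j) (n + length u) else 0)"
proof (cases "suffix u (ev j)")
  case True
  have "\<eta> j y = 0" if "\<not> suffix u y" for y
    using True that suffix_order.order_trans unfolding \<eta>_def by metis
  then show ?thesis using True by (simp add: word_sum_suffix)
next
  case False
  have "\<eta> j (w @ u) = 0" for w
  proof (rule ccontr)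
    assume "\<eta> j (w @ u) \<noteq> 0"
    then have s: "suffix (ev j) (w @ u)" by (metis \<eta>_def)
    show False
    proof (cases "length u \<le> length (ev j)")
      case True
      then show False using suffix_length_suffix[of u "w @ u" "ev j"] s False by (auto simp: suffix_def)
    next
      case False
      then show False using suffix_length_suffix[of "ev j" "w @ u" u] s nf by (auto simp: suffix_def)
    qed
  qed
  then show ?thesis using False by (simp add: word_sum_def)
qed

text \<open>When \<open>ev j\<close> is completed at the t-th letter of \<open>v\<close>, the part
  \<open>take t v\<close> is a suffix of \<open>ev j\<close>. These overlaps are the ones counted by
  the correlation of \<open>ev j\<close> with \<open>v\<close>.\<close>

lemma word_sum_\<mu>_append:
  assumes nf: "\<And>j. j < nev \<Longrightarrow> \<not> (sublist (ev j) v \<and> length (ev j) < length v)"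
  shows "word_sum (\<lambda>w. \<mu> (w @ v)) n = word_sum \<mu> n +
    (\<Sum>j<nev. \<delta> j * (\<Sum>t = 1..length v. if suffix (take t v) (ev j) then word_sum (\<eta> j) (n + t) else 0))"
proof -
  have "word_sum (\<lambda>w. \<mu> (w @ v)) n = word_sum \<mu> n +
    (\<Sum>w | length w = n. \<Sum>t = 1..length v. \<Sum>j<nev. \<delta> j * \<eta> j (w @ take t v))"
    unfolding word_sum_def by (subst \<mu>_append) (simp add: sum.distrib)
  also have "(\<Sum>w | length w = n. \<Sum>t = 1..length v. \<Sum>j<nev. \<delta> j * \<eta> j (w @ take t v))
    = (\<Sum>j<nev. \<Sum>t = 1..length v. \<delta> j * word_sum (\<lambda>w. \<eta> j (w @ take t v)) n)"
    unfolding word_sum_def sum_distrib_left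
    by (subst sum.swap, subst (2) sum.swap, subst sum.swap) simp
  also have "\<dots> = (\<Sum>j<nev. \<delta> j * (\<Sum>t = 1..length v. if suffix (take t v) (ev j) then word_sum (\<eta> j) (n + t) else 0))"
    unfolding sum_distrib_left
  proof (intro sum.cong refl)
    fix j t assume j: "j \<in> {..<nev}" and t: "t \<in> {1..length v}"
    have "\<not> (sublist (ev j) (take t v) \<and> length (ev j) < length (take t v))"
      using nf[of j] j t sublist_order.order_trans[OF _ sublist_take, of "ev j" t v] by auto
    then show "\<delta> j * word_sum (\<lambda>w. \<eta> j (w @ take t v)) n
       = \<delta> j * (if suffix (take t v) (ev j) then word_sum (\<eta> j) (n + t) else 0)"
      using word_sum_\<eta>_append[of j "take t v" n] j t by (simp add: min_absorb2)
  qed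
  finally show ?thesis .
qed

lemma word_sum_\<eta>_short: "n < length (ev j) \<Longrightarrow> word_sum (\<eta> j) n = 0"
  unfolding word_sum_def
  by (intro sum.neutral) (auto simp: \<eta>_def dest!: suffix_length_le)


section \<open>The matrix P over the polynomials, and bounds for the event weights\<close>

lemma sublist_ev_length:
  assumes "i < nev" "j < nev" shows "\<not> (sublist (ev i) (ev j) \<and> length (ev i) < length (ev j))"
  using reduced_ev[OF ev_in ev_in] assms by (metis less_irrefl)

lemma P_entry_eq:
  "P_entry forb rep m i j = monom (\<delta> j) 1 * corr_poly (ev j) (ev i)
     - (if i = j \<and> j < length rep then monom 1 p else 0)"
  using length_rep[of "rep ! j"]
  by (auto simp: P_entry_def \<delta>_def Let_def minus_monom[symmetric] simp del: minus_monom)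

definition P_poly :: "real poly mat" where
  "P_poly = mat nev nev (\<lambda>(i, j). P_entry forb rep m i j)"

lemma P_mat_eq: "P_mat forb rep m = map_mat to_fract P_poly"
  by (intro eq_matI) (auto simp: P_mat_def P_poly_def nev_def Let_def)

text \<open>The coefficient of column j at \<open>length (ev j)\<close> comes from offset 0, where
  agreement means that one word is a prefix of the other; reducedness confines this to the diagonal.
  There it is \<open>\<delta> j - 1 = - 1 / m j\<close> for a repeated word and -1 for a forbidden
  one.\<close>

lemma det_P_poly: "det P_poly \<noteq> 0"
proof (rule det_nonzero_if_dominant_diagonal[where c = "\<lambda>j. length (ev j)" and n = nev])
  show "P_poly \<in> carrier_mat nev nev" by (simp add: P_poly_def)
  fix i j assume ij: "i < nev" "j < nev"
  have pos: "0 < length (ev j)" "ev j \<noteq> []" using length_ev[of j] ij by auto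
  have "degree (monom (\<delta> j) 1 * corr_poly (ev j) (ev i)) \<le> length (ev j)"
    using degree_mult_le[of "monom (\<delta> j) 1" "corr_poly (ev j) (ev i)"]
      degree_corr_poly[of "ev j" "ev i"] degree_monom_le[of "\<delta> j" 1] pos(1) by linarith
  moreover have "length (ev j) = p" if "j < length rep" using that length_rep ev_rep by metis
  ultimately show "degree (P_poly $$ (i, j)) \<le> length (ev j)"
    using ij by (auto simp: P_poly_def P_entry_eq intro!: degree_diff_le order.trans[OF degree_monom_le])
  have c: "coeff (monom (\<delta> j) 1 * corr_poly (ev j) (ev i)) (length (ev j)) = \<delta> j * of_bool (prefix (ev j) (ev i) \<or> prefix (ev i) (ev j))"
    by (simp only: coeff_monom_1_mult[OF pos(1)] coeff_corr_poly[OF pos(2)] corr_coeff_0)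
  show "coeff (P_poly $$ (i, j)) (length (ev j)) = 0" if "i \<noteq> j"
    using reduced_ev[OF ev_in[OF ij(1)] ev_in[OF ij(2)]] reduced_ev[OF ev_in[OF ij(2)] ev_in[OF ij(1)]]
      ev_inj[OF ij] that ij c by (auto simp: P_poly_def P_entry_eq)
next
  fix i assume i: "i < nev"
  have pos: "0 < length (ev i)" "ev i \<noteq> []" using length_ev[of i] i by auto
  have c: "coeff (monom (\<delta> i) 1 * corr_poly (ev i) (ev i)) (length (ev i)) = \<delta> i"
    by (simp only: coeff_monom_1_mult[OF pos(1)] coeff_corr_poly[OF pos(2)] corr_coeff_0) simp
  show "coeff (P_poly $$ (i, i)) (length (ev i)) \<noteq> 0"
  proof (cases "i < length rep")
    case True
    then have "length (ev i) = p" using length_rep ev_rep by metis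
    then show ?thesis using i True two_le_m[OF True] c by (simp add: P_poly_def P_entry_eq \<delta>_def)
  next
    case False
    then show ?thesis using i c by (simp add: P_poly_def P_entry_eq \<delta>_def)
  qed
qed

lemma word_sum_\<eta>_rep: "j < length rep \<Longrightarrow> word_sum (\<eta> j) n \<le> word_sum \<mu> n"
  unfolding word_sum_def by (intro sum_mono) (simp add: \<eta>_def \<mu>_nonneg)

text \<open>The last letter is prescribed by \<open>ev j\<close>, so deleting it is injective on the
  words counted, and \<open>\<eta>\<close> is already the weight of what remains. This costs one
  index.\<close>

lemma word_sum_\<eta>_forb:
  assumes "length rep \<le> j" "j < nev" shows "word_sum (\<eta> j) (n + 1) \<le> word_sum \<mu> n"
proof -
  have "ev j \<noteq> []" using length_ev[OF assms(2)] by auto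
  then have "\<eta> j y = 0" if "\<not> suffix [last (ev j)] y" for y
    using that unfolding \<eta>_def
    by (metis append_butlast_last_id suffix_appendD)
  then have "word_sum (\<eta> j) (n + 1) = word_sum (\<lambda>w. \<eta> j (w @ [last (ev j)])) n"
    using word_sum_suffix[of "[last (ev j)]" "\<eta> j" n] by simp
  also have "\<dots> \<le> word_sum \<mu> n"
    unfolding word_sum_def using assms(1) by (intro sum_mono) (simp add: \<eta>_def \<mu>_nonneg)
  finally show ?thesis .
qed

lemma not_sublist_ev:
  assumes X: "clean X" "length X = p - 1" and j: "j < nev"
  shows "\<not> sublist (ev j) X"
proof
  assume s: "sublist (ev j) X"
  show False
  proof (cases "j < length rep")
    case True
    then have "length (ev j) = p" using length_rep ev_rep by metis
    then show False using sublist_length_le[OF s] X(2) two_le_p by simp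
  next
    case False
    then show False using ev_forb[of j] j s X(1) by (auto simp: clean_def)
  qed
qed

text \<open>Why the first symbol is removed: \<open>ev j\<close> may be one symbol longer than
  \<open>X\<close>, and offset 0 would then record \<open>X\<close> as a prefix of
  \<open>ev j\<close>, which is not an overlap at the end of \<open>ev j\<close>. No genuine overlap
  is lost, since one at offset 0 would place all of \<open>ev j\<close> inside
  \<open>X\<close>.\<close>

lemma corr_poly_tl_eval:
  assumes X: "clean X" "length X = p - 1" and j: "j < nev"
  shows "z * poly (corr_poly (tl (ev j)) X) z = (\<Sum>t = 1..length X. if suffix (take t X) (ev j) then z ^ t else 0)"
proof -
  have "\<not> (sublist X (tl (ev j)) \<and> length X < length (tl (ev j)))"
    using length_ev[OF j] X(2) by auto
  moreover have "suffix (take t X) (tl (ev j)) \<longleftrightarrow> suffix (take t X) (ev j)" for t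
  proof
    assume "suffix (take t X) (tl (ev j))"
    then show "suffix (take t X) (ev j)" using suffix_tl suffix_order.order_trans by blast
  next
    assume s: "suffix (take t X) (ev j)"
    have "take t X \<noteq> ev j" using not_sublist_ev[OF X j] sublist_take by metis
    then show "suffix (take t X) (tl (ev j))" using s
      by (cases "ev j") (auto simp: suffix_Cons)
  qed
  ultimately show ?thesis by (simp add: corr_poly_eval)
qed

end

text \<open>The number \<open>\<theta>\<close> is known here only through convergence beyond it and
  divergence towards it. Both pass to the reversed words, for which G is the same series, without
  any reference to an adjacency matrix.\<close>

locale weighted_words_radius = weighted_words +
  fixes \<theta> :: real
  assumes \<theta>_pos: "\<theta> > 0"
    and summable_\<mu>: "z > \<theta> \<Longrightarrow> summable (\<lambda>n. word_sum \<mu> n / z ^ n)"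
    and diverges: "filterlim (gser (word_sum \<mu>)) at_top (at_right \<theta>)"
begin

lemma summable_\<eta>:
  assumes "j < nev" "z > \<theta>"
  shows "summable (\<lambda>n. word_sum (\<eta> j) n / z ^ n)"
proof (cases "j < length rep")
  case True
  show ?thesis
  proof (rule summable_gser_comparison[OF _ summable_\<mu>[OF assms(2)]])
    show "z > 0" using \<theta>_pos assms(2) by simp
    show "0 \<le> word_sum (\<eta> j) n" for n by (intro word_sum_nonneg \<eta>_nonneg)
    show "word_sum (\<eta> j) n \<le> word_sum \<mu> n" for n using True by (rule word_sum_\<eta>_rep)
  qed
next
  case False
  have "summable (\<lambda>n. word_sum (\<eta> j) (n + 1) / z ^ n)"
  proof (rule summable_gser_comparison[OF _ summable_\<mu>[OF assms(2)]])
    show "z > 0" using \<theta>_pos assms(2) by simp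
    show "0 \<le> word_sum (\<eta> j) (n + 1)" for n by (intro word_sum_nonneg \<eta>_nonneg)
    show "word_sum (\<eta> j) (n + 1) \<le> word_sum \<mu> n" for n using False assms(1) by (intro word_sum_\<eta>_forb) auto
  qed
  then show ?thesis using \<theta>_pos assms(2) by (subst (asm) summable_gser_shift) auto
qed

text \<open>The constant covers both kinds of events: 1 for repeated words, and
  \<open>1 / z\<close>, at most \<open>1 / \<theta>\<close>, for the deleted letter of a forbidden
  word. Uniformity in \<open>z\<close> is what excludes a pole of the row sums at
  \<open>\<theta>\<close>.\<close>

lemma gser_\<eta>_bound:
  assumes "j < nev" "z > \<theta>"
  shows "0 \<le> gser (word_sum (\<eta> j)) z" "gser (word_sum (\<eta> j)) z \<le> max 1 (1 / \<theta>) * gser (word_sum \<mu>) z"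
proof -
  have z: "z > 0" using \<theta>_pos assms(2) by simp
  show "0 \<le> gser (word_sum (\<eta> j)) z"
    by (intro gser_nonneg z summable_\<eta> assms word_sum_nonneg \<eta>_nonneg)
  have G: "0 \<le> gser (word_sum \<mu>) z"
    by (intro gser_nonneg z summable_\<mu> assms word_sum_nonneg \<mu>_nonneg)
  show "gser (word_sum (\<eta> j)) z \<le> max 1 (1 / \<theta>) * gser (word_sum \<mu>) z"
  proof (cases "j < length rep")
    case True
    have "gser (word_sum (\<eta> j)) z \<le> 1 * gser (word_sum \<mu>) z"
      using True by (simp, intro gser_mono z summable_\<eta> summable_\<mu> assms word_sum_\<eta>_rep)
    also have "\<dots> \<le> max 1 (1 / \<theta>) * gser (word_sum \<mu>) z" using G by (intro mult_right_mono) auto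
    finally show ?thesis .
  next
    case False
    have 0: "word_sum (\<eta> j) 0 = 0" using length_ev[OF assms(1)] by (intro word_sum_\<eta>_short) linarith
    have "z * gser (word_sum (\<eta> j)) z = gser (\<lambda>n. word_sum (\<eta> j) (n + 1)) z"
      using gser_shift[of z "word_sum (\<eta> j)" 1] summable_\<eta>[OF assms] z 0 by simp
    also have "\<dots> \<le> gser (word_sum \<mu>) z"
    proof (intro gser_mono z summable_\<mu> assms)
      show "summable (\<lambda>n. word_sum (\<eta> j) (n + 1) / z ^ n)"
        using summable_\<eta>[OF assms] z by (subst summable_gser_shift) auto
    qed (use False assms word_sum_\<eta>_forb in auto)
    finally have "gser (word_sum (\<eta> j)) z \<le> 1 / z * gser (word_sum \<mu>) z" using z by (simp add: field_simps)
    also have "\<dots> \<le> max 1 (1 / \<theta>) * gser (word_sum \<mu>) z"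
    proof (intro mult_right_mono G)
      have "1 / z \<le> 1 / \<theta>" using assms \<theta>_pos by (simp add: frac_le)
      then show "1 / z \<le> max 1 (1 / \<theta>)" by simp
    qed
    finally show ?thesis .
  qed
qed

lemma gser_\<mu>_append:
  assumes z: "z > \<theta>"
    and nf: "\<And>j. j < nev \<Longrightarrow> \<not> (sublist (ev j) v \<and> length (ev j) < length v)"
  shows "gser (word_sum (\<lambda>w. \<mu> (w @ v))) z = gser (word_sum \<mu>) z +
    (\<Sum>j<nev. \<delta> j * (\<Sum>t = 1..length v. if suffix (take t v) (ev j) then z ^ t else 0) * gser (word_sum (\<eta> j)) z)"
proof -
  have z0: "z \<noteq> 0" using z \<theta>_pos by simp
  let ?b = "\<lambda>j t n. if suffix (take t v) (ev j) then word_sum (\<eta> j) (n + t) else 0"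
  have b: "(\<lambda>n. ?b j t n / z ^ n) sums ((if suffix (take t v) (ev j) then z ^ t else 0) * gser (word_sum (\<eta> j)) z)"
    if j: "j < nev" and t: "t \<in> {1..length v}" for j t
  proof (cases "suffix (take t v) (ev j)")
    case True
    \<comment> \<open>The coefficients of \<open>\<eta> j\<close> start at
      \<open>length (ev j)\<close>, so the shift by \<open>t\<close> drops only zeros and is exactly
      multiplication by \<open>z ^ t\<close>.\<close>
    then have "t \<le> length (ev j)" using suffix_length_le[OF True] t by (simp add: min_absorb2)
    then have "(\<Sum>i<t. word_sum (\<eta> j) i / z ^ i) = 0" by (intro sum.neutral) (auto simp: word_sum_\<eta>_short)
    then have "gser (\<lambda>n. word_sum (\<eta> j) (n + t)) z = z ^ t * gser (word_sum (\<eta> j)) z"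
      using gser_shift[OF z0 summable_\<eta>[OF j z], of t] by simp
    moreover have "summable (\<lambda>n. word_sum (\<eta> j) (n + t) / z ^ n)"
      using summable_\<eta>[OF j z] z0 by (subst summable_gser_shift)
    ultimately show ?thesis using True unfolding gser_def by (simp add: sums_iff)
  qed simp
  have "(\<lambda>n. word_sum (\<lambda>w. \<mu> (w @ v)) n / z ^ n) sums (gser (word_sum \<mu>) z +
    (\<Sum>j<nev. \<delta> j * (\<Sum>t = 1..length v. (if suffix (take t v) (ev j) then z ^ t else 0) * gser (word_sum (\<eta> j)) z)))"
  proof -
    have "(\<lambda>n. word_sum (\<lambda>w. \<mu> (w @ v)) n / z ^ n)
        = (\<lambda>n. word_sum \<mu> n / z ^ n + (\<Sum>j<nev. \<delta> j * (\<Sum>t = 1..length v. ?b j t n / z ^ n)))"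
      by (subst word_sum_\<mu>_append[OF nf])
        (simp_all add: add_divide_distrib sum_divide_distrib flip: times_divide_eq_right)
    then show ?thesis
      using summable_\<mu>[OF z] b unfolding gser_def
      by (auto intro!: sums_add sums_sum sums_mult summable_sums)
  qed
  then show ?thesis unfolding gser_def by (simp add: sums_iff sum_distrib_right mult.assoc)
qed

lemma word_sum_\<mu>_append_ev:
  assumes "i < nev"
  shows "word_sum (\<lambda>w. \<mu> (w @ ev i)) n = (if i < length rep then word_sum (\<eta> i) (n + p) else 0)"
proof (cases "i < length rep")
  case True
  then have "length (ev i) = p" using length_rep ev_rep by metis
  moreover have "word_sum (\<lambda>w. \<mu> (w @ ev i)) n = word_sum (\<lambda>w. \<eta> i (w @ ev i)) n"
    using True by (simp add: \<eta>_def suffix_def)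
  moreover have "\<eta> i y = 0" if "\<not> suffix (ev i) y" for y using that by (simp add: \<eta>_def)
  ultimately show ?thesis using True word_sum_suffix[of "ev i" "\<eta> i" n] by simp
next
  case False
  then have "ev i \<in> set forb" using ev_forb assms by simp
  then have "\<mu> (w @ ev i) = 0" for w unfolding \<mu>_def clean_def by auto
  then show ?thesis using False by (simp add: word_sum_def)
qed

text \<open>This is \<open>gser_\<mu>_append\<close> for \<open>v = ev i\<close>. Its left side is
  known: words ending with a forbidden word weigh nothing, and those ending with a repeated word
  give back \<open>z ^ p\<close> times their own series. The latter is the origin of the diagonal
  correction in P.\<close>

lemma P_system:
  assumes z: "z > \<theta>" and i: "i < nev"
  shows "(\<Sum>j<nev. poly (P_entry forb rep m i j) z * gser (word_sum (\<eta> j)) z) = - gser (word_sum \<mu>) z"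
proof -
  have z0: "z \<noteq> 0" using z \<theta>_pos by simp
  have lhs: "gser (word_sum (\<lambda>w. \<mu> (w @ ev i))) z = (if i < length rep then z ^ p * gser (word_sum (\<eta> i)) z else 0)"
  proof (cases "i < length rep")
    case True
    then have "length (ev i) = p" using length_rep ev_rep by metis
    then have "(\<Sum>t<p. word_sum (\<eta> i) t / z ^ t) = 0" by (intro sum.neutral) (auto simp: word_sum_\<eta>_short)
    moreover have "word_sum (\<lambda>w. \<mu> (w @ ev i)) = (\<lambda>n. word_sum (\<eta> i) (n + p))"
      using word_sum_\<mu>_append_ev[OF i] True by auto
    ultimately show ?thesis using True gser_shift[OF z0 summable_\<eta>[OF i z], of p] by simp
  next
    case False
    then have "word_sum (\<lambda>w. \<mu> (w @ ev i)) = (\<lambda>n. 0)"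
      using word_sum_\<mu>_append_ev[OF i] by auto
    then show ?thesis using False by (simp add: gser_def)
  qed
  have "poly (P_entry forb rep m i j) z * gser (word_sum (\<eta> j)) z =
      \<delta> j * (\<Sum>t = 1..length (ev i). if suffix (take t (ev i)) (ev j) then z ^ t else 0) * gser (word_sum (\<eta> j)) z
      - (if j = i then (if i < length rep then z ^ p * gser (word_sum (\<eta> i)) z else 0) else 0)" if j: "j < nev" for j
    using corr_poly_eval[OF sublist_ev_length[OF i j], of z]
    by (auto simp: P_entry_eq poly_monom algebra_simps)
  then have "(\<Sum>j<nev. poly (P_entry forb rep m i j) z * gser (word_sum (\<eta> j)) z) =
      (\<Sum>j<nev. \<delta> j * (\<Sum>t = 1..length (ev i). if suffix (take t (ev i)) (ev j) then z ^ t else 0) * gser (word_sum (\<eta> j)) z)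
      - (if i < length rep then z ^ p * gser (word_sum (\<eta> i)) z else 0)"
    using i by (simp add: sum_subtractf)
  also have "\<dots> = - gser (word_sum \<mu>) z"
    using gser_\<mu>_append[OF z sublist_ev_length[OF _ i]] lhs by simp
  finally show ?thesis .
qed

lemma gser_\<mu>_pos: "z > \<theta> \<Longrightarrow> gser (word_sum \<mu>) z > 0"
proof -
  assume z: "z > \<theta>"
  then have z0: "z > 0" using \<theta>_pos by simp
  have "word_sum \<mu> 0 = 1" by (simp add: word_sum_def \<mu>_Nil)
  then have "(\<Sum>n<1. word_sum \<mu> n / z ^ n) = 1" by simp
  moreover have "(\<Sum>n<1. word_sum \<mu> n / z ^ n) \<le> gser (word_sum \<mu>) z"
    unfolding gser_def using z0 by (intro sum_le_suminf summable_\<mu> z) (auto intro!: divide_nonneg_nonneg word_sum_nonneg \<mu>_nonneg)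
  ultimately show ?thesis by simp
qed

lemma \<eta>_ratio_tendsto:
  assumes j: "j < nev"
  shows "((\<lambda>z. gser (word_sum (\<eta> j)) z / gser (word_sum \<mu>) z) \<longlongrightarrow> - fract_value (R_fun forb rep m j) \<theta>) (at_right \<theta>)"
proof -
  define y where "y = (\<lambda>i z. - (gser (word_sum (\<eta> i)) z / gser (word_sum \<mu>) z))"
  have gt: "eventually (\<lambda>z. z > \<theta>) (at_right \<theta>)" by (simp add: eventually_at_right_less)
  have "(y j \<longlongrightarrow> fract_value (row_sum (mat_inv (map_mat to_fract P_poly)) j) \<theta>) (at_right \<theta>)"
  proof (rule row_sum_inverse_tendsto[OF _ det_P_poly j])
    show "P_poly \<in> carrier_mat nev nev" by (simp add: P_poly_def)
    show "eventually (\<lambda>z. \<forall>i<nev. (\<Sum>j<nev. poly (P_poly $$ (i, j)) z * y j z) = 1) (at_right \<theta>)"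
      using gt
    proof eventually_elim
      case (elim z)
      show ?case
      proof (intro allI impI)
        fix i assume i: "i < nev"
        have "(\<Sum>j<nev. poly (P_poly $$ (i, j)) z * y j z)
            = - (\<Sum>j<nev. poly (P_entry forb rep m i j) z * gser (word_sum (\<eta> j)) z) / gser (word_sum \<mu>) z"
          using i by (simp add: P_poly_def y_def sum_divide_distrib sum_negf)
        also have "\<dots> = 1" using P_system[OF elim i] gser_\<mu>_pos[OF elim] by simp
        finally show "(\<Sum>j<nev. poly (P_poly $$ (i, j)) z * y j z) = 1" .
      qed
    qed
    show "eventually (\<lambda>z. \<bar>y j z\<bar> \<le> max 1 (1 / \<theta>)) (at_right \<theta>)"
      using gt
    proof eventually_elim
      case (elim z)
      then show ?case using gser_\<eta>_bound[OF j elim] gser_\<mu>_pos[OF elim]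
        by (simp add: y_def abs_divide pos_divide_le_eq)
    qed
  qed
  from tendsto_minus[OF this] show ?thesis by (simp add: y_def R_fun_def P_mat_eq)
qed

lemma U_entry_eq:
  "U_entry forb rep m t X =
    1 - t * (\<Sum>j<nev. \<delta> j * fract_value (R_fun forb rep m j) t * poly (corr_poly (tl (ev j)) X) t)"
proof -
  have split: "(\<Sum>j<a + b. f j) = (\<Sum>j<a. f j) + (\<Sum>j<b. f (a + j))" for a b and f :: "nat \<Rightarrow> real"
    by (induction b) (simp_all add: add.assoc)
  have "(\<Sum>j<length rep. \<delta> j * fract_value (R_fun forb rep m j) t * poly (corr_poly (tl (ev j)) X) t)
    = (\<Sum>i<length rep. (1 - 1 / real (m i)) * fract_value (R_fun forb rep m i) t * poly (corr_poly (tl (rep ! i)) X) t)"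
    by (intro sum.cong) (auto simp: \<delta>_def nth_append)
  moreover have "(\<Sum>j<length forb. \<delta> (length rep + j) * fract_value (R_fun forb rep m (length rep + j)) t
      * poly (corr_poly (tl (ev (length rep + j))) X) t)
    = - (\<Sum>j<length forb. fract_value (R_fun forb rep m (length rep + j)) t * poly (corr_poly (tl (forb ! j)) X) t)"
    by (simp add: \<delta>_def sum_negf)
  ultimately show ?thesis
    unfolding U_entry_def nev_def split by (simp add: right_diff_distrib)
qed

lemma gser_append_ratio_tendsto:
  assumes X: "clean X" "length X = p - 1"
  shows "((\<lambda>z. gser (word_sum (\<lambda>w. \<mu> (w @ X))) z / gser (word_sum \<mu>) z) \<longlongrightarrow> U_entry forb rep m \<theta> X) (at_right \<theta>)"
proof -
  have gt: "eventually (\<lambda>z. z > \<theta>) (at_right \<theta>)" by (simp add: eventually_at_right_less)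
  have "((\<lambda>z. 1 + (\<Sum>j<nev. \<delta> j * (z * poly (corr_poly (tl (ev j)) X) z) * (gser (word_sum (\<eta> j)) z / gser (word_sum \<mu>) z)))
      \<longlongrightarrow> 1 + (\<Sum>j<nev. \<delta> j * (\<theta> * poly (corr_poly (tl (ev j)) X) \<theta>) * - fract_value (R_fun forb rep m j) \<theta>)) (at_right \<theta>)"
    by (intro tendsto_intros \<eta>_ratio_tendsto) auto
  also have "1 + (\<Sum>j<nev. \<delta> j * (\<theta> * poly (corr_poly (tl (ev j)) X) \<theta>) * - fract_value (R_fun forb rep m j) \<theta>) = U_entry forb rep m \<theta> X"
    by (simp add: U_entry_eq sum_distrib_left sum_negf mult_ac)
  finally show ?thesis
  proof (rule Lim_transform_eventually)
    show "eventually (\<lambda>z. 1 + (\<Sum>j<nev. \<delta> j * (z * poly (corr_poly (tl (ev j)) X) z) * (gser (word_sum (\<eta> j)) z / gser (word_sum \<mu>) z))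
      = gser (word_sum (\<lambda>w. \<mu> (w @ X))) z / gser (word_sum \<mu>) z) (at_right \<theta>)"
      using gt
    proof eventually_elim
      case (elim z)
      have "\<not> (sublist (ev j) X \<and> length (ev j) < length X)" if "j < nev" for j
        using not_sublist_ev[OF X that] by simp
      from gser_\<mu>_append[OF elim this] gser_\<mu>_pos[OF elim] show ?case
        by (simp add: corr_poly_tl_eval[OF X] add_divide_distrib sum_divide_distrib)
    qed
  qed
qed

end

subsection \<open>Reversal\<close>

context weighted_words
begin

lemma weighted_words_rev: "weighted_words (map rev forb) (map rev rep) m p"
proof
  show "2 \<le> p" by (rule two_le_p)
  show "length r = p" if "r \<in> set (map rev rep)" for r using that length_rep by auto
  show "2 \<le> length a \<and> length a \<le> p" if "a \<in> set (map rev forb)" for a using that length_forb by auto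
  have "distinct (map rev (rep @ forb))" using distinct_ev by (simp only: distinct_map) (auto intro: inj_onI)
  then show "distinct (map rev rep @ map rev forb)" by simp
  show "u = v" if "u \<in> set (map rev rep @ map rev forb)" "v \<in> set (map rev rep @ map rev forb)" "sublist u v" for u v
    using that reduced_ev[of "rev u" "rev v"] by (auto simp: sublist_rev_left)
  show "2 \<le> m i" if "i < length (map rev rep)" for i using that two_le_m by simp
qed

interpretation rev: weighted_words "map rev forb" "map rev rep" m p
  by (rule weighted_words_rev)

lemma rev_clean: "rev.clean w \<longleftrightarrow> clean (rev w)"
  by (simp add: rev.clean_def clean_def sublist_rev_left)

lemma rev_\<mu>: "rev.\<mu> w = \<mu> (rev w)"
  using word_mult_rev[of rep m "rev w"] by (simp add: rev.\<mu>_def \<mu>_def rev_clean)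

lemma rev_nev: "rev.nev = nev" by (simp add: rev.nev_def nev_def)

lemma rev_ev: "j < nev \<Longrightarrow> (map rev rep @ map rev forb) ! j = rev (ev j)"
  by (simp add: nev_def flip: map_append)

lemma rev_\<delta>: "rev.\<delta> = \<delta>"
  by (simp add: rev.\<delta>_def \<delta>_def fun_eq_iff)

lemma \<delta>_nonzero: "j < nev \<Longrightarrow> \<delta> j \<noteq> 0"
  using two_le_m[of j] by (auto simp: \<delta>_def)

text \<open>Entry (i, j) of the conjugate is entry (j, i) of P times D_j / D_i. Column i of P
  carries the factor D_i on its correlations, so conjugation replaces it by D_j, while reversal
  swaps the two words of the correlation. The correction by a power of z sits on the diagonal and is
  unaffected.\<close>

lemma Q_mat_eq: "Q_mat forb rep m = P_mat (map rev forb) (map rev rep) m"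
proof -
  let ?D = "\<lambda>i. to_fract (D_poly rep m i)"
  have D: "D_poly rep m j = monom (\<delta> j) 1" for j by (simp add: D_poly_def \<delta>_def)
  have D0: "?D i \<noteq> 0" if "i < nev" for i using \<delta>_nonzero[OF that] by (simp add: D monom_eq_0_iff)
  have Dm: "D_mat forb rep m = mat nev nev (\<lambda>(i, j). if i = j then ?D i else 0)"
    by (simp add: D_mat_def nev_def Let_def)
  have Dc: "D_mat forb rep m \<in> carrier_mat nev nev" "mat_inv (D_mat forb rep m) \<in> carrier_mat nev nev"
    using mat_inv_diagonal[of nev ?D] D0 by (auto simp: Dm)
  have Di: "mat_inv (D_mat forb rep m) = mat nev nev (\<lambda>(i, j). if i = j then inverse (?D i) else 0)"
    unfolding Dm using D0 by (rule mat_inv_diagonal)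
  have Pm: "P_mat forb rep m \<in> carrier_mat nev nev" by (simp add: P_mat_def nev_def Let_def)
  show ?thesis
  proof (rule eq_matI)
    fix i j assume "i < dim_row (P_mat (map rev forb) (map rev rep) m)" "j < dim_col (P_mat (map rev forb) (map rev rep) m)"
    then have ij: "i < nev" "j < nev" by (simp_all add: P_mat_def nev_def Let_def)
    have 1: "(mat_inv (D_mat forb rep m) * transpose_mat (P_mat forb rep m)) $$ (i, k)
      = inverse (?D i) * to_fract (P_entry forb rep m k i)" if k: "k < nev" for k
    proof -
      have "(mat_inv (D_mat forb rep m) * transpose_mat (P_mat forb rep m)) $$ (i, k)
        = (\<Sum>l = 0..<nev. (if i = l then inverse (?D i) else 0) * to_fract (P_entry forb rep m k l))"
        using ij k unfolding Di by (simp add: scalar_prod_def P_mat_def nev_def Let_def)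
      also have "\<dots> = (\<Sum>l = 0..<nev. if l = i then inverse (?D i) * to_fract (P_entry forb rep m k i) else 0)"
        by (intro sum.cong) auto
      finally show ?thesis using ij by simp
    qed
    have "Q_mat forb rep m $$ (i, j) = (\<Sum>k = 0..<nev.
        (mat_inv (D_mat forb rep m) * transpose_mat (P_mat forb rep m)) $$ (i, k) * (if k = j then ?D k else 0))"
    proof -
      define M where "M = mat_inv (D_mat forb rep m) * transpose_mat (P_mat forb rep m)"
      have "M \<in> carrier_mat nev nev" unfolding M_def Di using Pm by auto
      then show ?thesis
        using ij unfolding Q_mat_def M_def[symmetric] by (simp add: scalar_prod_def Dm)
    qed
    also have "\<dots> = (\<Sum>k = 0..<nev. if k = j then inverse (?D i) * to_fract (P_entry forb rep m j i) * ?D j else 0)"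
      by (intro sum.cong) (auto simp: 1)
    also have "\<dots> = inverse (?D i) * to_fract (P_entry forb rep m j i) * ?D j" using ij by simp
    also have "\<dots> = to_fract (P_entry (map rev forb) (map rev rep) m i j)"
    proof -
      have corr: "corr_poly (rev (ev j)) (rev (ev i)) = corr_poly (ev i) (ev j)"
        by (intro corr_poly_rev sublist_ev_length ij)
      have "P_entry forb rep m j i * D_poly rep m j
          = D_poly rep m i * P_entry (map rev forb) (map rev rep) m i j"
        unfolding P_entry_eq rev.P_entry_eq rev_ev[OF ij(1)] rev_ev[OF ij(2)] rev_\<delta> corr D
        by (auto simp: algebra_simps)
      then have "to_fract (P_entry forb rep m j i) * ?D j
          = ?D i * to_fract (P_entry (map rev forb) (map rev rep) m i j)"
        by (simp flip: to_fract_mult)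
      then show ?thesis using D0[OF ij(1)] by (simp add: field_simps)
    qed
    also have "\<dots> = P_mat (map rev forb) (map rev rep) m $$ (i, j)"
      using ij by (simp add: P_mat_def nev_def Let_def)
    finally show "Q_mat forb rep m $$ (i, j) = P_mat (map rev forb) (map rev rep) m $$ (i, j)" .
  qed (use Dc in \<open>simp_all add: Q_mat_def P_mat_def nev_def Let_def\<close>)
qed

text \<open>The left side deletes no symbol although the right side does: since \<open>ev j\<close>
  does not occur in \<open>X\<close>, every offset in the correlation of \<open>X\<close> with
  \<open>ev j\<close> is already a genuine overlap. The identity is obtained for \<open>t\<close>
  times the values, whence \<open>t \<noteq> 0\<close>.\<close>

lemma V_entry_eq:
  assumes X: "clean X" "length X = p - 1" and t: "t \<noteq> 0"
  shows "V_entry forb rep m t X = U_entry (map rev forb) (map rev rep) m t (rev X)"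
proof -
  have S: "S_fun forb rep m = R_fun (map rev forb) (map rev rep) m"
    by (simp add: S_fun_def R_fun_def Q_mat_eq fun_eq_iff)
  have corr: "poly (corr_poly (tl (rev (ev j))) (rev X)) t = poly (corr_poly X (ev j)) t" if j: "j < nev" for j
  proof -
    have "t * poly (corr_poly (tl (rev (ev j))) (rev X)) t
        = (\<Sum>s = 1..length X. if suffix (take s (rev X)) (rev (ev j)) then t ^ s else 0)"
      using rev.corr_poly_tl_eval[of "rev X" j t] X j by (simp add: rev_clean rev_nev rev_ev)
    also have "\<dots> = (\<Sum>s = 1..length (ev j). if suffix (take s (ev j)) X then t ^ s else 0)"
      by (rule corr_sum_rev[symmetric])
    also have "\<dots> = t * poly (corr_poly X (ev j)) t"
      using not_sublist_ev[OF X j] by (subst corr_poly_eval) auto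
    finally show ?thesis using t by simp
  qed
  have "poly (corr_poly (tl (rev (rep ! i))) (rev X)) t = poly (corr_poly X (rep ! i)) t" if "i < length rep" for i
    using corr[of i] that by (simp add: nev_def nth_append)
  moreover have "poly (corr_poly (tl (rev (forb ! i))) (rev X)) t = poly (corr_poly X (forb ! i)) t" if "i < length forb" for i
    using corr[of "length rep + i"] that by (simp add: nev_def nth_append)
  ultimately show ?thesis by (simp add: V_entry_def U_entry_def S)
qed

end

context weighted_words_radius
begin

lemma weighted_words_radius_rev: "weighted_words_radius (map rev forb) (map rev rep) m p \<theta>"
proof -
  interpret rev: weighted_words "map rev forb" "map rev rep" m p by (rule weighted_words_rev)
  have "word_sum rev.\<mu> = word_sum \<mu>" using word_sum_rev[of \<mu>] by (simp add: rev_\<mu>[abs_def] fun_eq_iff)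
  then show ?thesis
    using \<theta>_pos summable_\<mu> diverges by unfold_locales auto
qed

lemma gser_prepend_ratio_tendsto:
  assumes X: "clean X" "length X = p - 1"
  shows "((\<lambda>z. gser (word_sum (\<lambda>w. \<mu> (X @ w))) z / gser (word_sum \<mu>) z) \<longlongrightarrow> V_entry forb rep m \<theta> X) (at_right \<theta>)"
proof -
  interpret rev: weighted_words_radius "map rev forb" "map rev rep" m p \<theta> by (rule weighted_words_radius_rev)
  have "word_sum rev.\<mu> = word_sum \<mu>" using word_sum_rev[of \<mu>] by (simp add: rev_\<mu>[abs_def] fun_eq_iff)
  moreover have "word_sum (\<lambda>w. rev.\<mu> (w @ rev X)) = word_sum (\<lambda>w. \<mu> (X @ w))"
    using word_sum_rev[of "\<lambda>w. \<mu> (X @ w)"] by (simp add: rev_\<mu> fun_eq_iff)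
  ultimately show ?thesis
    using rev.gser_append_ratio_tendsto[of "rev X"] X V_entry_eq[OF X, of \<theta>] \<theta>_pos
    by (simp add: rev_clean)
qed

end

subsection \<open>Allowed words and the adjacency matrix\<close>

lemma occurs_in_seq_sublist: "occurs_in_seq w x \<Longrightarrow> sublist v w \<Longrightarrow> occurs_in_seq v x"
proof -
  assume "occurs_in_seq w x" "sublist v w"
  then obtain k a b where k: "\<forall>i<length w. x (k + i) = w ! i" and w: "w = a @ v @ b"
    by (auto simp: occurs_in_seq_def sublist_def)
  have "x (k + length a + i) = v ! i" if "i < length v" for i
    using k[rule_format, of "length a + i"] that by (simp add: w nth_append add.assoc)
  then show ?thesis unfolding occurs_in_seq_def by blast
qed

lemma allowed_sublist: "allowed F w \<Longrightarrow> sublist v w \<Longrightarrow> allowed F v"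
  unfolding allowed_def using occurs_in_seq_sublist by blast

lemma allowed_extend:
  assumes "allowed F w" shows "\<exists>v. length v = n \<and> allowed F (w @ v)"
proof -
  obtain x k where x: "x \<in> subshift F" and k: "\<forall>i<length w. x (k + i) = w ! i"
    using assms by (auto simp: allowed_def occurs_in_seq_def)
  define v where "v = map (\<lambda>i. x (k + length w + i)) [0..<n]"
  have "x (k + i) = (w @ v) ! i" if "i < length (w @ v)" for i
    using that k by (auto simp: v_def nth_append)
  then show ?thesis using x by (intro exI[of _ v]) (auto simp: v_def allowed_def occurs_in_seq_def)
qed

text \<open>A factor meeting both \<open>u\<close> and \<open>v\<close> covers \<open>X\<close> and
  at least one letter on each side, hence has at least \<open>length X + 2\<close> letters.\<close>

lemma sublist_overlap:
  assumes "sublist a (u @ X @ v)" "length a \<le> Suc (length X)"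
  shows "sublist a (u @ X) \<or> sublist a (X @ v)"
proof -
  obtain s t where st: "u @ X @ v = s @ a @ t" using assms(1) by (auto simp: sublist_def)
  show ?thesis
  proof (cases "length u \<le> length s")
    case True
    then have "X @ v = drop (length u) s @ a @ t"
      using arg_cong[OF st, of "drop (length u)"] by simp
    then show ?thesis by (auto simp: sublist_def)
  next
    case False
    then have "length (s @ a) \<le> length (u @ X)" using assms(2) by simp
    moreover have "prefix (s @ a) (u @ X @ v)" "prefix (u @ X) (u @ X @ v)"
      using st by (simp_all add: prefix_def) (metis append.assoc)+
    ultimately have "prefix (s @ a) (u @ X)" by (metis prefix_length_prefix)
    then show ?thesis by (auto simp: prefix_def sublist_def)
  qed
qed

context weighted_words
begin

abbreviation allowed_word :: "'a list \<Rightarrow> bool" where "allowed_word \<equiv> allowed (set forb)"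

definition states :: "'a list set" where "states = lang (set forb) (p - 1)"

lemma states_iff: "X \<in> states \<longleftrightarrow> length X = p - 1 \<and> allowed_word X"
  by (simp add: states_def lang_def)

lemma finite_states: "finite states"
  by (rule finite_subset[OF _ finite_list_length[of "p - 1"]]) (auto simp: states_iff)

lemma allowed_clean: "allowed_word w \<Longrightarrow> clean w"
  unfolding clean_def allowed_def subshift_def using occurs_in_seq_sublist by blast

lemma states_clean: "X \<in> states \<Longrightarrow> clean X" "X \<in> states \<Longrightarrow> length X = p - 1"
  by (auto simp: states_iff allowed_clean)

text \<open>Koenig's lemma for the tree of clean extensions of a word.\<close>

lemma allowed_if_extendable:
  assumes "\<And>n. \<exists>v. length v = n \<and> clean (w @ v)"
  shows "allowed_word w"
proof -
  define E where "E w \<longleftrightarrow> (\<forall>n. \<exists>v. length v = n \<and> clean (w @ v))" for w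
  have step: "\<exists>c. E (w @ [c])" if Ew: "E w" for w
  proof (rule ccontr)
    assume "\<not> (\<exists>c. E (w @ [c]))"
    then have "\<forall>c. \<exists>n. \<forall>v. length v = n \<longrightarrow> \<not> clean (w @ [c] @ v)" by (auto simp: E_def)
    then obtain N where N: "\<And>c v. length v = N c \<Longrightarrow> \<not> clean (w @ [c] @ v)" by metis
    \<comment> \<open>Long enough to outlast the failure length of every next letter; the maximum
      exists because the alphabet is finite, and one more letter is needed for
      \<open>c\<close>.\<close>
    obtain v where v: "length v = Suc (Max (range N))" "clean (w @ v)" using Ew unfolding E_def by blast
    then obtain c u where u: "v = c # u" by (cases v) auto
    have le: "N c \<le> length u" using v(1) u by simp
    have "sublist (w @ [c] @ take (N c) u) (w @ v)"
      using append_take_drop_id[of "N c" u] u by (metis append.assoc append_Cons append_Nil sublist_append_rightI)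
    then have "clean (w @ [c] @ take (N c) u)" using v(2) clean_sublist by blast
    then show False using N[of "take (N c) u" c] le by simp
  qed
  define next_word where "next_word u = u @ [SOME c. E (u @ [c])]" for u
  define W where "W k = (next_word ^^ k) w" for k
  have W_Suc: "W (Suc k) = W k @ [SOME c. E (W k @ [c])]" for k by (simp add: W_def next_word_def)
  have EW: "E (W k)" for k
  proof (induction k)
    case 0
    then show ?case using assms by (simp add: W_def E_def)
  next
    case (Suc k)
    then show ?case unfolding W_Suc using someI_ex[OF step] by blast
  qed
  have len: "length (W k) = length w + k" for k by (induction k) (simp_all add: W_Suc, simp add: W_def)
  have pre: "W (k + j) ! i = W k ! i" if "i < length w + k" for i j k
    using that by (induction j) (simp_all add: W_Suc nth_append len)
  \<comment> \<open>Stage \<open>Suc i\<close> is the first one sure to have a letter at position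
    \<open>i\<close>, even when \<open>w\<close> is empty.\<close>
  define x where "x i = W (Suc i) ! i" for i
  have xW: "x i = W k ! i" if "i < length w + k" for i k
  proof (cases "k \<le> Suc i")
    case True
    then show ?thesis using pre[of i k "Suc i - k"] that by (simp add: x_def)
  next
    case False
    then show ?thesis using pre[of i "Suc i" "k - Suc i"] by (simp add: x_def)
  qed
  have "x \<in> subshift (set forb)"
  proof -
    have False if a: "a \<in> set forb" and occ: "occurs_in_seq a x" for a
    proof -
      obtain k where k: "\<forall>i<length a. x (k + i) = a ! i" using occ by (auto simp: occurs_in_seq_def)
      have "a = take (length a) (drop k (W (k + length a)))"
        using k by (intro nth_equalityI) (auto simp: len xW[of _ "k + length a"])
      then have "sublist a (W (k + length a))" by (metis sublist_take sublist_drop sublist_order.order_trans)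
      moreover have "clean (W (k + length a))" using EW[of "k + length a"] by (auto simp: E_def dest: spec[of _ 0])
      ultimately show False using a by (auto simp: clean_def)
    qed
    then show ?thesis by (auto simp: subshift_def)
  qed
  moreover have "occurs_in_seq w x"
    unfolding occurs_in_seq_def using xW[of _ 0] by (intro exI[of _ 0]) (auto simp: W_def)
  ultimately show ?thesis by (auto simp: allowed_def)
qed

lemma clean_glue:
  assumes "length X = p - 1"
  shows "clean (u @ X @ v) \<longleftrightarrow> clean (u @ X) \<and> clean (X @ v)"
proof
  assume "clean (u @ X @ v)"
  moreover have "sublist (u @ X) (u @ X @ v)" using sublist_append_rightI[of "u @ X" v] by simp
  ultimately show "clean (u @ X) \<and> clean (X @ v)" using clean_sublist by blast
next
  assume *: "clean (u @ X) \<and> clean (X @ v)"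
  show "clean (u @ X @ v)"
    unfolding clean_def
  proof
    fix a assume a: "a \<in> set forb"
    then have "length a \<le> Suc (length X)" using length_forb[OF a] assms two_le_p by simp
    then show "\<not> sublist a (u @ X @ v)" using sublist_overlap * a unfolding clean_def by blast
  qed
qed

text \<open>Extendability to the right is inherited from the state: a forbidden word has at most p
  letters and cannot reach across \<open>X\<close> from \<open>u\<close> into the extension.\<close>

lemma allowed_glue:
  assumes "X \<in> states" "clean (u @ X)"
  shows "allowed_word (u @ X)"
proof (rule allowed_if_extendable)
  fix n
  obtain v where "length v = n" "allowed_word (X @ v)"
    using allowed_extend[of "set forb" X n] assms(1) by (auto simp: states_iff)
  then show "\<exists>v. length v = n \<and> clean ((u @ X) @ v)"
    using assms clean_glue[of X u v] allowed_clean states_iff by (intro exI[of _ v]) auto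
qed

text \<open>\<open>allowed_if_extendable\<close> bounds the clean extensions of each single word
  that is not allowed, and there are only finitely many words of length \<open>p - 1\<close>. The
  bound is what separates avoiding \<open>forb\<close> from being allowed.\<close>

lemma bounded_extension:
  "\<exists>K. \<forall>X v. length X = p - 1 \<longrightarrow> X \<notin> states \<longrightarrow> K \<le> length v \<longrightarrow> \<not> clean (X @ v)"
proof -
  have "\<exists>n. \<forall>v. length v = n \<longrightarrow> \<not> clean (X @ v)" if "length X = p - 1" "X \<notin> states" for X
    using allowed_if_extendable[of X] that by (auto simp: states_iff)
  then obtain N where N: "\<And>X v. length X = p - 1 \<Longrightarrow> X \<notin> states \<Longrightarrow> length v = N X \<Longrightarrow> \<not> clean (X @ v)"
    by metis
  define K where "K = Max (N ` {X. length X = p - 1})"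
  have "\<not> clean (X @ v)" if X: "length X = p - 1" "X \<notin> states" and v: "K \<le> length v" for X v
  proof
    assume c: "clean (X @ v)"
    have "N X \<le> K" unfolding K_def using X by (intro Max_ge finite_imageI finite_list_length) auto
    moreover have "sublist (X @ take (N X) v) (X @ v)"
      using append_take_drop_id[of "N X" v] by (metis append.assoc sublist_append_rightI)
    ultimately show False using N[OF X, of "take (N X) v"] v c clean_sublist by auto
  qed
  then show ?thesis by blast
qed

text \<open>The weight has memory \<open>p - 1\<close>: an event completed by \<open>c\<close> lies
  within \<open>X @ [c]\<close>, and \<open>X\<close> is too short to contain a repeated word, so it
  is not counted twice.\<close>

lemma \<mu>_glue_snoc:
  assumes X: "length X = p - 1"
  shows "\<mu> (w @ X @ [c]) = \<mu> (w @ X) * \<mu> (X @ [c])"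
proof -
  have "suffix (rep ! i) ((w @ X) @ [c]) \<longleftrightarrow> suffix (rep ! i) (X @ [c])" if "i < length rep" for i
  proof
    assume s: "suffix (rep ! i) ((w @ X) @ [c])"
    have "length (rep ! i) \<le> length (X @ [c])" using length_rep[of "rep ! i"] that X two_le_p by simp
    moreover have "suffix (X @ [c]) ((w @ X) @ [c])" by (simp add: suffix_def)
    ultimately show "suffix (rep ! i) (X @ [c])" using suffix_length_suffix[OF s] by blast
  next
    assume "suffix (rep ! i) (X @ [c])"
    then show "suffix (rep ! i) ((w @ X) @ [c])" using suffix_appendI[of "rep ! i" "X @ [c]" w] by simp
  qed
  then have "(\<Prod>i<length rep. if suffix (rep ! i) ((w @ X) @ [c]) then m i else 1)
    = (\<Prod>i<length rep. if suffix (rep ! i) (X @ [c]) then m i else 1)"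
    by (intro prod.cong) (simp_all del: suffix_snoc)
  moreover have "word_mult rep m X = 1" using X two_le_p by (intro word_mult_short) simp
  ultimately have "word_mult rep m (w @ X @ [c]) = word_mult rep m (w @ X) * word_mult rep m (X @ [c])"
    using word_mult_snoc[of "w @ X" c] word_mult_snoc[of X c] by simp
  then show ?thesis using clean_glue[OF X, of w "[c]"] by (simp add: \<mu>_def)
qed

lemma \<mu>_glue_Cons:
  assumes X: "length X = p - 1"
  shows "\<mu> (c # X @ w) = \<mu> (c # X) * \<mu> (X @ w)"
proof -
  interpret rev: weighted_words "map rev forb" "map rev rep" m p by (rule weighted_words_rev)
  have "rev.\<mu> (rev w @ rev X @ [c]) = rev.\<mu> (rev w @ rev X) * rev.\<mu> (rev X @ [c])"
    using X by (intro rev.\<mu>_glue_snoc) simp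
  then show ?thesis by (simp add: rev_\<mu>)
qed

lemma \<mu>_le_snoc: "\<mu> (w @ [c]) \<le> real (\<Prod>i<length rep. m i) * \<mu> w"
proof (cases "clean (w @ [c])")
  case True
  then have "clean w" by (simp add: clean_snoc)
  have one_le_m: "1 \<le> m i" if "i < length rep" for i using two_le_m[OF that] by simp
  have "(\<Prod>i<length rep. if suffix (rep ! i) (w @ [c]) then m i else 1) \<le> (\<Prod>i<length rep. m i)"
    using one_le_m by (intro prod_mono) (simp del: suffix_snoc)
  then have "word_mult rep m (w @ [c]) \<le> (\<Prod>i<length rep. m i) * word_mult rep m w"
    unfolding word_mult_snoc by (simp add: mult.commute)
  then show ?thesis using True \<open>clean w\<close>
    unfolding \<mu>_def by (simp only: if_True of_nat_mult[symmetric] of_nat_le_iff)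
qed (simp add: \<mu>_def prod_nonneg)

lemma \<mu>_append_le: "\<mu> (w @ v) \<le> real (\<Prod>i<length rep. m i) ^ length v * \<mu> w"
proof (induction v rule: rev_induct)
  case (snoc c v)
  have "\<mu> (w @ v @ [c]) \<le> real (\<Prod>i<length rep. m i) * \<mu> (w @ v)" using \<mu>_le_snoc[of "w @ v" c] by simp
  also have "\<dots> \<le> real (\<Prod>i<length rep. m i) * (real (\<Prod>i<length rep. m i) ^ length v * \<mu> w)"
    using snoc by (intro mult_left_mono) (auto simp: prod_nonneg)
  finally show ?case by (simp add: mult.assoc)
qed simp

section \<open>Transfer recursions over the states\<close>

abbreviation weight :: "'a list \<Rightarrow> 'a list \<Rightarrow> real" where
  "weight \<equiv> adj_entry forb rep m p"

text \<open>Only \<open>Y\<close> has to be a state: \<open>X @ [last Y]\<close> is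
  \<open>hd X # Y\<close>, and a clean word ending with a state is allowed.\<close>

lemma weight_eq:
  assumes "length X = p - 1" "Y \<in> states"
  shows "weight X Y = (if tl X = butlast Y then \<mu> (X @ [last Y]) else 0)"
proof (cases "tl X = butlast Y")
  case True
  have "X \<noteq> []" "Y \<noteq> []" using assms two_le_p by (auto simp: states_iff)
  then have XY: "X @ [last Y] = [hd X] @ Y" using True
    by (metis append_Cons append_Nil append_butlast_last_id list.collapse)
  have "X @ [last Y] \<in> lang (set forb) p \<longleftrightarrow> clean (X @ [last Y])"
    unfolding lang_def XY using allowed_glue[OF assms(2), of "[hd X]"] allowed_clean assms two_le_p
    by (auto simp: states_iff)
  then show ?thesis using True by (simp add: adj_entry_def \<mu>_def)
qed (simp add: adj_entry_def)

text \<open>The letter just before \<open>Y\<close> is moved into the window. The recursion is exact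
  for every \<open>n\<close>, because a predecessor that is not a state makes \<open>c # Y\<close>
  unclean and contributes zero.\<close>

lemma word_sum_append_Suc:
  assumes Y: "Y \<in> states"
  shows "word_sum (\<lambda>w. \<mu> (w @ Y)) (Suc n) = (\<Sum>X\<in>states. word_sum (\<lambda>w. \<mu> (w @ X)) n * weight X Y)"
proof -
  have Y0: "Y \<noteq> []" and lenY: "length Y = p - 1" using Y two_le_p by (auto simp: states_iff)
  define X where "X c = c # butlast Y" for c
  have X: "X c @ [last Y] = c # Y" "length (X c) = p - 1" for c
    using Y0 lenY two_le_p by (auto simp: X_def)
  have "word_sum (\<lambda>w. \<mu> (w @ Y)) (Suc n) = (\<Sum>c\<in>UNIV. word_sum (\<lambda>w. \<mu> (w @ X c @ [last Y])) n)"
    unfolding word_sum_def sum_lists_Suc_snoc X by simp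
  also have "\<dots> = (\<Sum>c\<in>UNIV. word_sum (\<lambda>w. \<mu> (w @ X c)) n * \<mu> (X c @ [last Y]))"
    unfolding word_sum_def by (simp add: \<mu>_glue_snoc[OF X(2)] sum_distrib_right)
  also have "\<dots> = (\<Sum>Z\<in>range X. word_sum (\<lambda>w. \<mu> (w @ Z)) n * \<mu> (Z @ [last Y]))"
    by (subst sum.reindex) (auto simp: inj_on_def X_def)
  also have "\<dots> = (\<Sum>Z\<in>range X \<inter> states. word_sum (\<lambda>w. \<mu> (w @ Z)) n * \<mu> (Z @ [last Y]))"
  proof (rule sum.mono_neutral_right)
    show "\<forall>Z\<in>range X - range X \<inter> states. word_sum (\<lambda>w. \<mu> (w @ Z)) n * \<mu> (Z @ [last Y]) = 0"
    proof
      fix Z assume "Z \<in> range X - range X \<inter> states"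
      then obtain c where c: "Z = X c" "X c \<notin> states" by auto
      have "\<not> clean (c # Y)"
      proof
        assume "clean (c # Y)"
        then have "allowed_word (c # Y)" using allowed_glue[OF Y, of "[c]"] by simp
        moreover have "sublist (X c) (c # Y)" using X(1)[of c] sublist_append_rightI by metis
        ultimately show False using c X(2) allowed_sublist by (auto simp: states_iff)
      qed
      then show "word_sum (\<lambda>w. \<mu> (w @ Z)) n * \<mu> (Z @ [last Y]) = 0" by (simp add: c X \<mu>_def)
    qed
  qed auto
  also have "\<dots> = (\<Sum>Z\<in>range X \<inter> states. word_sum (\<lambda>w. \<mu> (w @ Z)) n * weight Z Y)"
    by (intro sum.cong refl) (auto simp: weight_eq[OF X(2) Y], auto simp: X_def)
  also have "\<dots> = (\<Sum>Z\<in>states. word_sum (\<lambda>w. \<mu> (w @ Z)) n * weight Z Y)"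
  proof (rule sum.mono_neutral_left[OF finite_states])
    show "\<forall>Z\<in>states - range X \<inter> states. word_sum (\<lambda>w. \<mu> (w @ Z)) n * weight Z Y = 0"
    proof
      fix Z assume Z: "Z \<in> states - range X \<inter> states"
      then have "Z \<noteq> []" using two_le_p by (auto simp: states_iff)
      then have "tl Z \<noteq> butlast Y" using Z unfolding X_def by (cases Z) auto
      then show "word_sum (\<lambda>w. \<mu> (w @ Z)) n * weight Z Y = 0" by (simp add: adj_entry_def)
    qed
  qed auto
  finally show ?thesis .
qed

text \<open>Here a successor that is not a state can still have short clean continuations. They are
  exhausted once the remaining word has at least \<open>K\<close> letters.\<close>

lemma word_sum_prepend_Suc:
  assumes X: "X \<in> states"
    and K: "\<forall>Y v. length Y = p - 1 \<longrightarrow> Y \<notin> states \<longrightarrow> K \<le> length v \<longrightarrow> \<not> clean (Y @ v)"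
    and n: "K \<le> n"
  shows "word_sum (\<lambda>w. \<mu> (X @ w)) (Suc n) = (\<Sum>Y\<in>states. weight X Y * word_sum (\<lambda>w. \<mu> (Y @ w)) n)"
proof -
  have X0: "X \<noteq> []" and lenX: "length X = p - 1" using X two_le_p by (auto simp: states_iff)
  define Y where "Y c = tl X @ [c]" for c
  have Y: "X @ [c] = hd X # Y c" "length (Y c) = p - 1" for c
    using X0 lenX two_le_p by (auto simp: Y_def)
  \<comment> \<open>Reversing the summation variable lets the decomposition by last letters peel off
    the letter next to \<open>X\<close>.\<close>
  have "word_sum (\<lambda>w. \<mu> (X @ w)) (Suc n) = word_sum (\<lambda>w. \<mu> (X @ rev w)) (Suc n)"
    by (rule word_sum_rev[symmetric])
  also have "\<dots> = (\<Sum>c\<in>UNIV. word_sum (\<lambda>w. \<mu> (X @ c # rev w)) n)"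
    unfolding word_sum_def sum_lists_Suc_snoc by simp
  also have "\<dots> = (\<Sum>c\<in>UNIV. word_sum (\<lambda>w. \<mu> (X @ c # w)) n)"
    by (intro sum.cong refl word_sum_rev)
  also have "\<dots> = (\<Sum>c\<in>UNIV. \<mu> (X @ [c]) * word_sum (\<lambda>w. \<mu> (Y c @ w)) n)"
  proof (intro sum.cong refl)
    fix c
    have "\<mu> (X @ c # w) = \<mu> (X @ [c]) * \<mu> (Y c @ w)" for w
    proof -
      have "X @ c # w = hd X # Y c @ w" using X0 by (cases X) (simp_all add: Y_def)
      then have "\<mu> (X @ c # w) = \<mu> (hd X # Y c @ w)" by (rule arg_cong)
      also have "\<dots> = \<mu> (X @ [c]) * \<mu> (Y c @ w)"
        unfolding Y(1) by (rule \<mu>_glue_Cons[OF Y(2)])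
      finally show ?thesis .
    qed
    then show "word_sum (\<lambda>w. \<mu> (X @ c # w)) n = \<mu> (X @ [c]) * word_sum (\<lambda>w. \<mu> (Y c @ w)) n"
      unfolding word_sum_def sum_distrib_left by (intro sum.cong refl)
  qed
  also have "\<dots> = (\<Sum>Z\<in>range Y. \<mu> (X @ [last Z]) * word_sum (\<lambda>w. \<mu> (Z @ w)) n)"
    by (subst sum.reindex) (auto simp: inj_on_def Y_def)
  also have "\<dots> = (\<Sum>Z\<in>range Y \<inter> states. \<mu> (X @ [last Z]) * word_sum (\<lambda>w. \<mu> (Z @ w)) n)"
  proof (rule sum.mono_neutral_right)
    show "\<forall>Z\<in>range Y - range Y \<inter> states. \<mu> (X @ [last Z]) * word_sum (\<lambda>w. \<mu> (Z @ w)) n = 0"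
    proof
      fix Z assume "Z \<in> range Y - range Y \<inter> states"
      then have "length Z = p - 1" "Z \<notin> states" using Y(2) by auto
      then have "\<not> clean (Z @ w)" if "length w = n" for w
        using K[rule_format, of Z w] n that by simp
      then show "\<mu> (X @ [last Z]) * word_sum (\<lambda>w. \<mu> (Z @ w)) n = 0" by (simp add: word_sum_def \<mu>_def)
    qed
  qed auto
  also have "\<dots> = (\<Sum>Z\<in>range Y \<inter> states. weight X Z * word_sum (\<lambda>w. \<mu> (Z @ w)) n)"
  proof (intro sum.cong refl)
    fix Z assume Z: "Z \<in> range Y \<inter> states"
    then have "tl X = butlast Z" by (auto simp: Y_def)
    then show "\<mu> (X @ [last Z]) * word_sum (\<lambda>w. \<mu> (Z @ w)) n = weight X Z * word_sum (\<lambda>w. \<mu> (Z @ w)) n"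
      using weight_eq[OF lenX, of Z] Z by simp
  qed
  also have "\<dots> = (\<Sum>Z\<in>states. weight X Z * word_sum (\<lambda>w. \<mu> (Z @ w)) n)"
  proof (rule sum.mono_neutral_left[OF finite_states])
    show "\<forall>Z\<in>states - range Y \<inter> states. weight X Z * word_sum (\<lambda>w. \<mu> (Z @ w)) n = 0"
    proof
      fix Z assume Z: "Z \<in> states - range Y \<inter> states"
      then have "Z \<noteq> []" using two_le_p by (auto simp: states_iff)
      have "tl X \<noteq> butlast Z"
      proof
        assume "tl X = butlast Z"
        then have "Z = Y (last Z)" using \<open>Z \<noteq> []\<close> by (simp add: Y_def)
        then show False using Z by blast
      qed
      then show "weight X Z * word_sum (\<lambda>w. \<mu> (Z @ w)) n = 0" by (simp add: adj_entry_def)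
    qed
  qed auto
  finally show ?thesis .
qed

text \<open>The last \<open>p - 1 + K\<close> letters are split as \<open>X @ u\<close> with
  \<open>u\<close> of length \<open>K\<close>. If \<open>X\<close> is not a state, \<open>u\<close>
  is long enough to make the word unclean; otherwise \<open>u\<close> raises the weight by at most
  the factor \<open>M\<close>. The constant \<open>C\<close> adds up \<open>M\<close> over all such
  suffixes.\<close>

lemma word_sum_\<mu>_le:
  assumes K: "\<forall>Y v. length Y = p - 1 \<longrightarrow> Y \<notin> states \<longrightarrow> K \<le> length v \<longrightarrow> \<not> clean (Y @ v)"
  shows "\<exists>C\<ge>0. \<forall>n. word_sum \<mu> (n + (p - 1 + K)) \<le> C * (\<Sum>X\<in>states. word_sum (\<lambda>w. \<mu> (w @ X)) n)"
proof -
  define M where "M = real (\<Prod>i<length rep. m i) ^ K"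
  have M: "M \<ge> 0" by (simp add: M_def prod_nonneg)
  define C where "C = (\<Sum>v :: 'a list | length v = p - 1 + K. M)"
  have "word_sum \<mu> (n + (p - 1 + K)) \<le> C * (\<Sum>X\<in>states. word_sum (\<lambda>w. \<mu> (w @ X)) n)" for n
  proof -
    have "word_sum (\<lambda>w. \<mu> (w @ v)) n \<le> M * (\<Sum>X\<in>states. word_sum (\<lambda>w. \<mu> (w @ X)) n)"
      if v: "length v = p - 1 + K" for v
    proof -
      define X u where "X = take (p - 1) v" and "u = drop (p - 1) v"
      have Xu: "v = X @ u" "length X = p - 1" "length u = K" using v by (auto simp: X_def u_def)
      have S: "0 \<le> (\<Sum>X\<in>states. word_sum (\<lambda>w. \<mu> (w @ X)) n)"
        by (intro sum_nonneg word_sum_nonneg \<mu>_nonneg)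
      show ?thesis
      proof (cases "X \<in> states")
        case True
        have "word_sum (\<lambda>w. \<mu> (w @ v)) n \<le> M * word_sum (\<lambda>w. \<mu> (w @ X)) n"
          unfolding word_sum_def sum_distrib_left M_def
          using \<mu>_append_le[of "w @ X" u for w] Xu by (intro sum_mono) simp
        also have "\<dots> \<le> M * (\<Sum>X\<in>states. word_sum (\<lambda>w. \<mu> (w @ X)) n)"
          using True finite_states M
          by (intro mult_left_mono member_le_sum[where f = "\<lambda>X. word_sum (\<lambda>w. \<mu> (w @ X)) n"] word_sum_nonneg \<mu>_nonneg)
        finally show ?thesis .
      next
        case False
        then have "\<not> clean (X @ u)" using K Xu by auto
        then have "\<not> clean (w @ v)" for w using clean_sublist[of "w @ v" v] Xu(1) by auto
        then show ?thesis using S M by (simp add: word_sum_def \<mu>_def)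
      qed
    qed
    then have "(\<Sum>v | length v = p - 1 + K. word_sum (\<lambda>w. \<mu> (w @ v)) n)
        \<le> (\<Sum>v :: 'a list | length v = p - 1 + K. M * (\<Sum>X\<in>states. word_sum (\<lambda>w. \<mu> (w @ X)) n))"
      by (intro sum_mono) auto
    then show ?thesis
      unfolding C_def sum_distrib_right[symmetric] by (simp add: word_sum_def sum_lists_add[of \<mu>])
  qed
  moreover have "C \<ge> 0" using M by (simp add: C_def)
  ultimately show ?thesis by blast
qed

text \<open>At the left end the rest of the word is itself the long extension, so an initial block
  that is not a state contributes nothing and equality holds.\<close>

lemma word_sum_\<mu>_prepend:
  assumes K: "\<forall>Y v. length Y = p - 1 \<longrightarrow> Y \<notin> states \<longrightarrow> K \<le> length v \<longrightarrow> \<not> clean (Y @ v)"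
    and n: "K \<le> n"
  shows "word_sum \<mu> (n + (p - 1)) = (\<Sum>X\<in>states. word_sum (\<lambda>w. \<mu> (X @ w)) n)"
proof -
  have "word_sum \<mu> (n + (p - 1)) = (\<Sum>X | length X = p - 1. word_sum (\<lambda>w. \<mu> (X @ w)) n)"
    unfolding word_sum_def add.commute[of n] sum_lists_add by (rule sum.swap)
  also have "\<dots> = (\<Sum>X\<in>states. word_sum (\<lambda>w. \<mu> (X @ w)) n)"
  proof (rule sum.mono_neutral_right[OF finite_list_length])
    show "\<forall>X\<in>{X. length X = p - 1} - states. word_sum (\<lambda>w. \<mu> (X @ w)) n = 0"
    proof
      fix X assume "X \<in> {X. length X = p - 1} - states"
      then have "\<not> clean (X @ w)" if "length w = n" for w using K n that by auto
      then show "word_sum (\<lambda>w. \<mu> (X @ w)) n = 0" by (simp add: word_sum_def \<mu>_def)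
    qed
  qed (auto simp: states_iff)
  finally show ?thesis .
qed

lemma sum_states_append_le:
  "(\<Sum>X\<in>states. word_sum (\<lambda>w. \<mu> (w @ X)) n) \<le> word_sum \<mu> (n + (p - 1))"
proof -
  have "word_sum \<mu> (n + (p - 1)) = (\<Sum>X | length X = p - 1. word_sum (\<lambda>w. \<mu> (w @ X)) n)"
    unfolding word_sum_def by (rule sum_lists_add)
  then show ?thesis
    by (simp, intro sum_mono2 finite_list_length word_sum_nonneg \<mu>_nonneg) (auto simp: states_iff)
qed

lemma one_le_sum_states_append:
  assumes "allowed_word []"
  shows "1 \<le> (\<Sum>X\<in>states. word_sum (\<lambda>w. \<mu> (w @ X)) n)"
proof -
  obtain v where v: "length v = n + (p - 1)" "allowed_word v"
    using allowed_extend[OF assms, of "n + (p - 1)"] by auto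
  define w X where "w = take n v" and "X = drop n v"
  have wX: "v = w @ X" "length w = n" "length X = p - 1" using v by (auto simp: w_def X_def)
  have X: "X \<in> states" using v(2) wX allowed_sublist[of _ v X] by (auto simp: states_iff)
  have "1 \<le> \<mu> (w @ X)" using v(2) wX(1) allowed_clean word_mult_pos[of "w @ X"] by (simp add: \<mu>_def)
  also have "\<dots> \<le> word_sum (\<lambda>w. \<mu> (w @ X)) n"
    unfolding word_sum_def using wX(2)
    by (intro member_le_sum[where f = "\<lambda>w. \<mu> (w @ X)"] finite_list_length \<mu>_nonneg) auto
  also have "\<dots> \<le> (\<Sum>X\<in>states. word_sum (\<lambda>w. \<mu> (w @ X)) n)"
    using X by (intro member_le_sum[where f = "\<lambda>X. word_sum (\<lambda>w. \<mu> (w @ X)) n"] finite_states word_sum_nonneg \<mu>_nonneg)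
  finally show ?thesis .
qed

end

subsection \<open>Powers of nonnegative matrices\<close>

lemma smult_pow_mat:
  fixes A :: "'b::comm_ring_1 mat"
  assumes A: "A \<in> carrier_mat n n"
  shows "(c \<cdot>\<^sub>m A) ^\<^sub>m k = c ^ k \<cdot>\<^sub>m (A ^\<^sub>m k)"
proof (induction k)
  case 0
  show ?case by (intro eq_matI) auto
next
  case (Suc k)
  have "A ^\<^sub>m k \<in> carrier_mat n n" using A by simp
  then have "(c ^ k \<cdot>\<^sub>m A ^\<^sub>m k) * (c \<cdot>\<^sub>m A) = c ^ Suc k \<cdot>\<^sub>m (A ^\<^sub>m k * A)"
    using A mult_smult_assoc_mat[of "A ^\<^sub>m k" n n "c \<cdot>\<^sub>m A" n "c ^ k"]
      mult_smult_distrib[of "A ^\<^sub>m k" n n A n c]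
    by (intro eq_matI) (auto simp: mult_ac)
  then show ?case using Suc by simp
qed

lemma perron_root_nonneg:
  assumes "A \<in> carrier_mat n n" "n > 0"
  shows "perron_root A \<ge> 0"
  using spectral_radius_mem_max(1)[of "map_mat complex_of_real A" n] assms
  by (auto simp: perron_root_def)

text \<open>Scaling by \<open>1 / t\<close> brings the spectral radius strictly below 1, where the
  Jordan normal form bounds all powers. The strict gap absorbs the polynomial growth coming from
  Jordan blocks.\<close>

lemma pow_entry_bound:
  assumes A: "A \<in> carrier_mat n n" and n: "n > 0" and t: "perron_root A < t"
  shows "\<exists>c. \<forall>k. \<forall>i<n. \<forall>j<n. \<bar>(A ^\<^sub>m k) $$ (i, j)\<bar> \<le> c * t ^ k"
proof -
  let ?C = "map_mat complex_of_real A"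
  let ?B = "complex_of_real (1 / t) \<cdot>\<^sub>m ?C"
  have t0: "t > 0" using perron_root_nonneg[OF A n] t by simp
  have C: "?C \<in> carrier_mat n n" and B: "?B \<in> carrier_mat n n" using A by auto
  obtain ev where ev: "ev \<in> spectrum ?B" "spectral_radius ?B = norm ev"
    using spectral_radius_mem_max(1)[OF B n] by auto
  then obtain v where v: "v \<in> carrier_vec n" "v \<noteq> 0\<^sub>v n" "?B *\<^sub>v v = ev \<cdot>\<^sub>v v"
    using B by (auto simp: spectrum_def eigenvalue_def eigenvector_def)
  have "?C *\<^sub>v v = (complex_of_real t * ev) \<cdot>\<^sub>v v"
  proof -
    have "?B *\<^sub>v v = complex_of_real (1 / t) \<cdot>\<^sub>v (?C *\<^sub>v v)"
      using C v(1) by (intro eq_vecI) (auto simp: scalar_prod_def sum_distrib_left mult.assoc)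
    then have "complex_of_real t \<cdot>\<^sub>v (ev \<cdot>\<^sub>v v) = complex_of_real t \<cdot>\<^sub>v (complex_of_real (1 / t) \<cdot>\<^sub>v (?C *\<^sub>v v))"
      using v(3) by simp
    then show ?thesis using t0 by (simp add: smult_smult_assoc flip: of_real_mult)
  qed
  then have "complex_of_real t * ev \<in> spectrum ?C"
    using v C by (auto simp: spectrum_def eigenvalue_def eigenvector_def)
  then have "norm (complex_of_real t * ev) \<le> perron_root A"
    unfolding perron_root_def by (intro spectral_radius_mem_max(2)[OF C n]) auto
  then have "t * norm ev < t * 1" using t abs_of_pos[OF t0] by (simp only: norm_mult norm_of_real mult_1_right)
  then have "norm ev < 1" using t0 by (simp only: mult_less_cancel_left_pos)
  then have "spectral_radius ?B < 1" using ev(2) by simp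
  then obtain c where c: "\<And>k. norm_bound (?B ^\<^sub>m k) c"
    using spectral_radius_jnf_norm_bound_less_1_upper_triangular[OF B] by blast
  have hom: "map_mat complex_of_real (A ^\<^sub>m k) = ?C ^\<^sub>m k" for k
    by (rule of_real_hom.mat_hom_pow[OF A])
  have "\<bar>(A ^\<^sub>m k) $$ (i, j)\<bar> \<le> c * t ^ k" if ij: "i < n" "j < n" for k i j
  proof -
    have pow: "?B ^\<^sub>m k = complex_of_real (1 / t) ^ k \<cdot>\<^sub>m map_mat complex_of_real (A ^\<^sub>m k)"
      unfolding hom by (rule smult_pow_mat[OF C])
    have "norm ((?B ^\<^sub>m k) $$ (i, j)) \<le> c"
      using c[of k] ij pow_carrier_mat[OF B, of k] unfolding norm_bound_def
      by (metis carrier_matD(1,2))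
    then have "\<bar>(A ^\<^sub>m k) $$ (i, j)\<bar> / t ^ k \<le> c"
      unfolding pow using ij carrier_matD[OF A] t0
      by (simp add: norm_mult norm_power norm_divide power_one_over)
    then show ?thesis using t0 by (simp add: pos_divide_le_eq)
  qed
  then show ?thesis by blast
qed

definition entry_sum :: "real mat \<Rightarrow> real" where
  "entry_sum M = (\<Sum>i<dim_row M. \<Sum>j<dim_col M. M $$ (i, j))"

lemma nonneg_pow_mat:
  fixes A :: "real mat"
  assumes A: "A \<in> carrier_mat n n" and nn: "\<And>i j. i < n \<Longrightarrow> j < n \<Longrightarrow> A $$ (i, j) \<ge> 0"
  shows "i < n \<Longrightarrow> j < n \<Longrightarrow> (A ^\<^sub>m k) $$ (i, j) \<ge> 0"
proof (induction k arbitrary: i j)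
  case 0
  then show ?case using A by simp
next
  case (Suc k)
  have "A ^\<^sub>m k \<in> carrier_mat n n" using A by simp
  then have "(A ^\<^sub>m Suc k) $$ (i, j) = (\<Sum>l = 0..<n. (A ^\<^sub>m k) $$ (i, l) * A $$ (l, j))"
    using A Suc.prems by (simp add: scalar_prod_def)
  also have "\<dots> \<ge> 0" using Suc nn by (intro sum_nonneg) auto
  finally show ?case .
qed

lemma summable_entry_sum:
  assumes A: "A \<in> carrier_mat n n" and n: "n > 0"
    and z: "perron_root A < z"
  shows "summable (\<lambda>k. entry_sum (A ^\<^sub>m k) / z ^ k)"
proof -
  have \<theta>: "perron_root A \<ge> 0" using perron_root_nonneg[OF A n] .
  obtain t where t: "perron_root A < t" "t < z" using dense[OF z] by blast
  then have t0: "0 < t" "0 < z" using \<theta> by auto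
  obtain c where c: "\<And>k i j. i < n \<Longrightarrow> j < n \<Longrightarrow> \<bar>(A ^\<^sub>m k) $$ (i, j)\<bar> \<le> c * t ^ k"
    using pow_entry_bound[OF A n t(1)] by blast
  have dim: "dim_row (A ^\<^sub>m k) = n" "dim_col (A ^\<^sub>m k) = n" for k using A by (auto intro: pow_carrier_mat)
  show ?thesis
  proof (rule summable_comparison_test')
    show "summable (\<lambda>k. (real n * (real n * c)) * (t / z) ^ k)"
      using t t0 by (intro summable_mult summable_geometric) auto
    fix k :: nat assume "k \<ge> 0"
    have "\<bar>entry_sum (A ^\<^sub>m k)\<bar> \<le> (\<Sum>i<n. \<Sum>j<n. c * t ^ k)"
      unfolding entry_sum_def dim
      by (rule order.trans[OF sum_abs sum_mono], rule order.trans[OF sum_abs sum_mono]) (use c in auto)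
    then show "norm (entry_sum (A ^\<^sub>m k) / z ^ k) \<le> real n * (real n * c) * (t / z) ^ k"
      using t0 by (simp add: power_divide divide_right_mono mult.assoc)
  qed
qed

text \<open>For an eigenvector \<open>v\<close> whose eigenvalue has maximal modulus, a nonzero
  coordinate of \<open>v\<close> is bounded by the rescaled entry sum times the 1-norm of
  \<open>v\<close>. The terms of the series therefore do not tend to zero.\<close>

lemma not_summable_entry_sum:
  assumes A: "A \<in> carrier_mat n n" and n: "n > 0"
    and nn: "\<And>i j. i < n \<Longrightarrow> j < n \<Longrightarrow> A $$ (i, j) \<ge> 0" and \<theta>: "perron_root A > 0"
  shows "\<not> summable (\<lambda>k. entry_sum (A ^\<^sub>m k) / perron_root A ^ k)"
proof
  let ?C = "map_mat complex_of_real A" and ?\<theta> = "perron_root A"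
  assume "summable (\<lambda>k. entry_sum (A ^\<^sub>m k) / ?\<theta> ^ k)"
  then have lim: "(\<lambda>k. entry_sum (A ^\<^sub>m k) / ?\<theta> ^ k) \<longlonglongrightarrow> 0" by (rule summable_LIMSEQ_zero)
  have C: "?C \<in> carrier_mat n n" using A by auto
  obtain ev where ev: "ev \<in> spectrum ?C" "?\<theta> = norm ev"
    using spectral_radius_mem_max(1)[OF C n] by (auto simp: perron_root_def)
  then obtain v where v: "eigenvector ?C v ev" by (auto simp: spectrum_def eigenvalue_def)
  then have vc: "v \<in> carrier_vec n" "v \<noteq> 0\<^sub>v n" using C by (auto simp: eigenvector_def)
  then obtain i where i: "i < n" "v $ i \<noteq> 0" by (metis eq_vecI carrier_vecD index_zero_vec(1,2))
  have dim: "dim_row (A ^\<^sub>m k) = n" "dim_col (A ^\<^sub>m k) = n" for k using A by (auto intro: pow_carrier_mat)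
  have Ak: "A ^\<^sub>m k \<in> carrier_mat n n" for k using A by simp
  have hom: "map_mat complex_of_real (A ^\<^sub>m k) = ?C ^\<^sub>m k" for k
    by (rule of_real_hom.mat_hom_pow[OF A])
  define S where "S = (\<Sum>j<n. norm (v $ j))"
  have "norm (v $ i) \<le> entry_sum (A ^\<^sub>m k) / ?\<theta> ^ k * S" for k
  proof -
    have nnk: "(A ^\<^sub>m k) $$ (i, j) \<ge> 0" if "i < n" "j < n" for i j using nonneg_pow_mat[OF A nn] that by blast
    have "map_mat complex_of_real (A ^\<^sub>m k) *\<^sub>v v = ev ^ k \<cdot>\<^sub>v v"
      unfolding hom by (rule eigenvector_pow[OF C v])
    then have "(map_mat complex_of_real (A ^\<^sub>m k) *\<^sub>v v) $ i = ev ^ k * v $ i"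
      using i vc by simp
    moreover have "(map_mat complex_of_real (A ^\<^sub>m k) *\<^sub>v v) $ i = (\<Sum>j<n. complex_of_real ((A ^\<^sub>m k) $$ (i, j)) * v $ j)"
      using i carrier_vecD[OF vc(1)] carrier_matD[OF A] by (simp add: scalar_prod_def lessThan_atLeast0)
    ultimately have "norm (ev ^ k * v $ i) = norm (\<Sum>j<n. complex_of_real ((A ^\<^sub>m k) $$ (i, j)) * v $ j)" by simp
    also have "\<dots> \<le> (\<Sum>j<n. (A ^\<^sub>m k) $$ (i, j) * norm (v $ j))"
      using nnk i by (intro sum_norm_le) (simp add: norm_mult)
    also have "\<dots> \<le> (\<Sum>j<n. entry_sum (A ^\<^sub>m k) * norm (v $ j))"
    proof (intro sum_mono mult_right_mono)
      fix j assume j: "j \<in> {..<n}"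
      have "(A ^\<^sub>m k) $$ (i, j) \<le> (\<Sum>j<n. (A ^\<^sub>m k) $$ (i, j))"
        using j i nnk by (intro member_le_sum) auto
      also have "\<dots> \<le> entry_sum (A ^\<^sub>m k)"
        unfolding entry_sum_def dim using i nnk
        by (intro member_le_sum[where f = "\<lambda>i. \<Sum>j<n. (A ^\<^sub>m k) $$ (i, j)"] sum_nonneg) auto
      finally show "(A ^\<^sub>m k) $$ (i, j) \<le> entry_sum (A ^\<^sub>m k)" .
    qed auto
    also have "\<dots> = entry_sum (A ^\<^sub>m k) * S" by (simp add: S_def sum_distrib_left)
    finally have "?\<theta> ^ k * norm (v $ i) \<le> entry_sum (A ^\<^sub>m k) * S" by (simp add: norm_mult norm_power ev(2))
    then show ?thesis using \<theta> by (simp add: field_simps)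
  qed
  moreover have "(\<lambda>k. entry_sum (A ^\<^sub>m k) / ?\<theta> ^ k * S) \<longlonglongrightarrow> 0" using tendsto_mult_right[OF lim, of S] by simp
  ultimately have "norm (v $ i) \<le> 0" by (intro LIMSEQ_le_const[of _ 0 "norm (v $ i)"]) auto
  then show False using i by simp
qed

subsection \<open>The Perron eigenvectors\<close>

context weighted_words_radius
begin

text \<open>The limit as a functional on coefficient sequences: linear, monotone, and turning an
  index shift into a factor \<open>\<theta>\<close>. An eigenvector equation then says that two
  expressions for one sequence have the same ratio.\<close>

definition has_ratio :: "(nat \<Rightarrow> real) \<Rightarrow> real \<Rightarrow> bool" where
  "has_ratio a l \<longleftrightarrow> (\<forall>z>\<theta>. summable (\<lambda>n. a n / z ^ n)) \<and>
     ((\<lambda>z. gser a z / gser (word_sum \<mu>) z) \<longlongrightarrow> l) (at_right \<theta>)"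

lemma eventually_gt_\<theta>: "eventually (\<lambda>z. z > \<theta>) (at_right \<theta>)"
  by (simp add: eventually_at_right_less)

lemma has_ratio_unique: "has_ratio a l \<Longrightarrow> has_ratio a l' \<Longrightarrow> l = l'"
  unfolding has_ratio_def using tendsto_unique trivial_limit_at_right_real by blast

text \<open>This is where the divergence of G enters: the finitely many terms cut off by the shift
  stay bounded near \<open>\<theta>\<close> and vanish after division by G.\<close>

lemma has_ratio_shift:
  assumes "has_ratio a l" shows "has_ratio (\<lambda>n. a (n + t)) (\<theta> ^ t * l)"
proof -
  have sm: "summable (\<lambda>n. a n / z ^ n)" if "z > \<theta>" for z using assms that by (simp add: has_ratio_def)
  have sm': "summable (\<lambda>n. a (n + t) / z ^ n)" if "z > \<theta>" for z
    using sm[OF that] \<theta>_pos that by (subst summable_gser_shift) auto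
  have "((\<lambda>z. (\<Sum>i<t. a i / z ^ i) / gser (word_sum \<mu>) z) \<longlongrightarrow> 0) (at_right \<theta>)"
  proof (rule tendsto_divide_0)
    show "((\<lambda>z. \<Sum>i<t. a i / z ^ i) \<longlongrightarrow> (\<Sum>i<t. a i / \<theta> ^ i)) (at_right \<theta>)"
      using \<theta>_pos by (intro tendsto_intros) auto
    show "filterlim (gser (word_sum \<mu>)) at_infinity (at_right \<theta>)"
      using diverges by (rule filterlim_at_top_imp_at_infinity)
  qed
  then have "((\<lambda>z. z ^ t * (gser a z / gser (word_sum \<mu>) z - (\<Sum>i<t. a i / z ^ i) / gser (word_sum \<mu>) z))
      \<longlongrightarrow> \<theta> ^ t * (l - 0)) (at_right \<theta>)"
    using assms unfolding has_ratio_def by (intro tendsto_intros) auto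
  then have "((\<lambda>z. gser (\<lambda>n. a (n + t)) z / gser (word_sum \<mu>) z) \<longlongrightarrow> \<theta> ^ t * (l - 0)) (at_right \<theta>)"
  proof (rule Lim_transform_eventually)
    show "eventually (\<lambda>z. z ^ t * (gser a z / gser (word_sum \<mu>) z - (\<Sum>i<t. a i / z ^ i) / gser (word_sum \<mu>) z)
      = gser (\<lambda>n. a (n + t)) z / gser (word_sum \<mu>) z) (at_right \<theta>)"
      using eventually_gt_\<theta>
    proof eventually_elim
      case (elim z)
      then show ?case using gser_shift[of z a t] sm[OF elim] \<theta>_pos
        by (simp add: diff_divide_distrib[symmetric])
    qed
  qed
  then show ?thesis using sm' by (simp add: has_ratio_def)
qed

lemma has_ratio_sum:
  assumes "\<And>i. i \<in> I \<Longrightarrow> has_ratio (a i) (l i)"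
  shows "has_ratio (\<lambda>n. \<Sum>i\<in>I. c i * a i n) (\<Sum>i\<in>I. c i * l i)"
proof -
  have sm: "summable (\<lambda>n. a i n / z ^ n)" if "z > \<theta>" "i \<in> I" for z i
    using assms that by (simp add: has_ratio_def)
  have "summable (\<lambda>n. \<Sum>i\<in>I. c i * (a i n / z ^ n))" if "z > \<theta>" for z
    using sm[OF that] by (intro summable_sum summable_mult)
  then have "summable (\<lambda>n. (\<Sum>i\<in>I. c i * a i n) / z ^ n)" if "z > \<theta>" for z
    using that by (simp add: sum_divide_distrib)
  moreover have "((\<lambda>z. gser (\<lambda>n. \<Sum>i\<in>I. c i * a i n) z / gser (word_sum \<mu>) z) \<longlongrightarrow> (\<Sum>i\<in>I. c i * l i)) (at_right \<theta>)"
  proof (rule Lim_transform_eventually)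
    show "((\<lambda>z. \<Sum>i\<in>I. c i * (gser (a i) z / gser (word_sum \<mu>) z)) \<longlongrightarrow> (\<Sum>i\<in>I. c i * l i)) (at_right \<theta>)"
      using assms unfolding has_ratio_def by (intro tendsto_intros) auto
    show "eventually (\<lambda>z. (\<Sum>i\<in>I. c i * (gser (a i) z / gser (word_sum \<mu>) z))
        = gser (\<lambda>n. \<Sum>i\<in>I. c i * a i n) z / gser (word_sum \<mu>) z) (at_right \<theta>)"
      using eventually_gt_\<theta>
    proof eventually_elim
      case (elim z)
      show ?case by (subst gser_sum[OF sm[OF elim]]) (simp_all add: sum_divide_distrib)
    qed
  qed
  ultimately show ?thesis by (simp add: has_ratio_def)
qed

lemma has_ratio_word_sum: "has_ratio (word_sum \<mu>) 1"
proof -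
  have "((\<lambda>z. gser (word_sum \<mu>) z / gser (word_sum \<mu>) z) \<longlongrightarrow> 1) (at_right \<theta>)"
    by (rule Lim_transform_eventually[OF tendsto_const], rule eventually_mono[OF eventually_gt_\<theta>])
      (use gser_\<mu>_pos in force)
  then show ?thesis using summable_\<mu> by (simp add: has_ratio_def)
qed

lemma has_ratio_mono:
  assumes "has_ratio a l" "has_ratio b l'" "\<And>n. a n \<le> b n" shows "l \<le> l'"
proof (rule tendsto_le[OF trivial_limit_at_right_real])
  show "((\<lambda>z. gser a z / gser (word_sum \<mu>) z) \<longlongrightarrow> l) (at_right \<theta>)"
    and "((\<lambda>z. gser b z / gser (word_sum \<mu>) z) \<longlongrightarrow> l') (at_right \<theta>)"
    using assms by (auto simp: has_ratio_def)
  show "eventually (\<lambda>z. gser a z / gser (word_sum \<mu>) z \<le> gser b z / gser (word_sum \<mu>) z) (at_right \<theta>)"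
    using eventually_gt_\<theta>
  proof eventually_elim
    case (elim z)
    have "gser a z \<le> gser b z"
      using assms elim \<theta>_pos by (intro gser_mono) (auto simp: has_ratio_def)
    then show ?case using gser_\<mu>_pos[OF elim] by (simp add: divide_right_mono)
  qed
qed

lemma has_ratio_append:
  assumes X: "X \<in> states" shows "has_ratio (word_sum (\<lambda>w. \<mu> (w @ X))) (U_entry forb rep m \<theta> X)"
proof -
  have "summable (\<lambda>n. word_sum (\<lambda>w. \<mu> (w @ X)) n / z ^ n)" if z: "z > \<theta>" for z
  proof (rule summable_gser_comparison)
    show "summable (\<lambda>n. word_sum \<mu> (n + length X) / z ^ n)"
      using summable_\<mu>[OF z] \<theta>_pos z by (subst summable_gser_shift) auto
  qed (use z \<theta>_pos in \<open>auto intro: word_sum_nonneg word_sum_append_le \<mu>_nonneg\<close>)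
  then show ?thesis
    using gser_append_ratio_tendsto[OF states_clean[OF X]] by (simp add: has_ratio_def)
qed

lemma has_ratio_prepend:
  assumes X: "X \<in> states" shows "has_ratio (word_sum (\<lambda>w. \<mu> (X @ w))) (V_entry forb rep m \<theta> X)"
proof -
  have le: "word_sum (\<lambda>w. \<mu> (X @ w)) n \<le> word_sum \<mu> (n + length X)" for n
    using word_sum_append_le[of "\<lambda>w. \<mu> (rev w)" "rev X" n] \<mu>_nonneg
      word_sum_rev[of "\<lambda>w. \<mu> (X @ w)" n] word_sum_rev[of \<mu> "n + length X"] by simp
  have "summable (\<lambda>n. word_sum (\<lambda>w. \<mu> (X @ w)) n / z ^ n)" if z: "z > \<theta>" for z
  proof (rule summable_gser_comparison)
    show "summable (\<lambda>n. word_sum \<mu> (n + length X) / z ^ n)"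
      using summable_\<mu>[OF z] \<theta>_pos z by (subst summable_gser_shift) auto
  qed (use z \<theta>_pos le in \<open>auto intro: word_sum_nonneg \<mu>_nonneg\<close>)
  then show ?thesis
    using gser_prepend_ratio_tendsto[OF states_clean[OF X]] by (simp add: has_ratio_def)
qed

lemma U_eigen:
  assumes Y: "Y \<in> states"
  shows "(\<Sum>X\<in>states. weight X Y * U_entry forb rep m \<theta> X) = \<theta> * U_entry forb rep m \<theta> Y"
proof (rule has_ratio_unique)
  show "has_ratio (\<lambda>n. \<Sum>X\<in>states. weight X Y * word_sum (\<lambda>w. \<mu> (w @ X)) n)
      (\<Sum>X\<in>states. weight X Y * U_entry forb rep m \<theta> X)"
    by (intro has_ratio_sum has_ratio_append)
  have "has_ratio (\<lambda>n. word_sum (\<lambda>w. \<mu> (w @ Y)) (n + 1)) (\<theta> ^ 1 * U_entry forb rep m \<theta> Y)"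
    by (intro has_ratio_shift has_ratio_append Y)
  then show "has_ratio (\<lambda>n. \<Sum>X\<in>states. weight X Y * word_sum (\<lambda>w. \<mu> (w @ X)) n) (\<theta> * U_entry forb rep m \<theta> Y)"
    by (simp add: word_sum_append_Suc[OF Y] mult.commute)
qed

lemma V_eigen:
  assumes X: "X \<in> states"
  shows "(\<Sum>Y\<in>states. weight X Y * V_entry forb rep m \<theta> Y) = \<theta> * V_entry forb rep m \<theta> X"
proof -
  obtain K where K: "\<forall>Y v. length Y = p - 1 \<longrightarrow> Y \<notin> states \<longrightarrow> K \<le> length v \<longrightarrow> \<not> clean (Y @ v)"
    using bounded_extension by blast
  \<comment> \<open>The recursion for prefixes starts only at length \<open>K\<close>, so both sides
    are shifted by \<open>K\<close>; the resulting factor \<open>\<theta> ^ K\<close> is cancelled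
    at the end.\<close>
  have "(\<Sum>Y\<in>states. weight X Y * (\<theta> ^ K * V_entry forb rep m \<theta> Y)) = \<theta> ^ Suc K * V_entry forb rep m \<theta> X"
  proof (rule has_ratio_unique)
    show "has_ratio (\<lambda>n. \<Sum>Y\<in>states. weight X Y * word_sum (\<lambda>w. \<mu> (Y @ w)) (n + K))
        (\<Sum>Y\<in>states. weight X Y * (\<theta> ^ K * V_entry forb rep m \<theta> Y))"
      by (intro has_ratio_sum has_ratio_shift has_ratio_prepend)
    have "word_sum (\<lambda>w. \<mu> (X @ w)) (n + Suc K) = (\<Sum>Y\<in>states. weight X Y * word_sum (\<lambda>w. \<mu> (Y @ w)) (n + K))" for n
      using word_sum_prepend_Suc[OF X K, of "n + K"] by simp
    then show "has_ratio (\<lambda>n. \<Sum>Y\<in>states. weight X Y * word_sum (\<lambda>w. \<mu> (Y @ w)) (n + K))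
        (\<theta> ^ Suc K * V_entry forb rep m \<theta> X)"
      using has_ratio_shift[OF has_ratio_prepend[OF X], of "Suc K"] by simp
  qed
  then have "\<theta> ^ K * (\<Sum>Y\<in>states. weight X Y * V_entry forb rep m \<theta> Y) = \<theta> ^ K * (\<theta> * V_entry forb rep m \<theta> X)"
    by (simp add: sum_distrib_left mult_ac)
  then show ?thesis using \<theta>_pos by simp
qed

text \<open>Up to the constant \<open>C\<close>, words ending with a state dominate a shift of G,
  whose ratio is a power of \<open>\<theta>\<close>. If all \<open>U_entry\<close> vanished, this
  power would be at most zero.\<close>

lemma U_nonzero: "\<exists>X\<in>states. U_entry forb rep m \<theta> X \<noteq> 0"
proof (rule ccontr)
  assume "\<not> ?thesis"
  then have U: "U_entry forb rep m \<theta> X = 0" if "X \<in> states" for X using that by blast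
  obtain K where K: "\<forall>Y v. length Y = p - 1 \<longrightarrow> Y \<notin> states \<longrightarrow> K \<le> length v \<longrightarrow> \<not> clean (Y @ v)"
    using bounded_extension by blast
  obtain C where C: "\<And>n. word_sum \<mu> (n + (p - 1 + K)) \<le> C * (\<Sum>X\<in>states. word_sum (\<lambda>w. \<mu> (w @ X)) n)"
    using word_sum_\<mu>_le[OF K] by blast
  have "\<theta> ^ (p - 1 + K) * 1 \<le> (\<Sum>X\<in>states. C * U_entry forb rep m \<theta> X)"
  proof (rule has_ratio_mono)
    show "has_ratio (\<lambda>n. word_sum \<mu> (n + (p - 1 + K))) (\<theta> ^ (p - 1 + K) * 1)"
      by (intro has_ratio_shift has_ratio_word_sum)
    show "has_ratio (\<lambda>n. \<Sum>X\<in>states. C * word_sum (\<lambda>w. \<mu> (w @ X)) n) (\<Sum>X\<in>states. C * U_entry forb rep m \<theta> X)"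
      by (intro has_ratio_sum has_ratio_append)
  qed (use C in \<open>simp add: sum_distrib_left\<close>)
  moreover have "\<theta> ^ (p - 1 + K) > 0" using \<theta>_pos by simp
  ultimately show False using U by simp
qed

lemma V_nonzero: "\<exists>X\<in>states. V_entry forb rep m \<theta> X \<noteq> 0"
proof (rule ccontr)
  assume "\<not> ?thesis"
  then have V: "V_entry forb rep m \<theta> X = 0" if "X \<in> states" for X using that by blast
  obtain K where K: "\<forall>Y v. length Y = p - 1 \<longrightarrow> Y \<notin> states \<longrightarrow> K \<le> length v \<longrightarrow> \<not> clean (Y @ v)"
    using bounded_extension by blast
  have "\<theta> ^ (K + (p - 1)) * 1 = (\<Sum>X\<in>states. 1 * (\<theta> ^ K * V_entry forb rep m \<theta> X))"
  proof (rule has_ratio_unique)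
    show "has_ratio (\<lambda>n. word_sum \<mu> (n + (K + (p - 1)))) (\<theta> ^ (K + (p - 1)) * 1)"
      by (intro has_ratio_shift has_ratio_word_sum)
    have "word_sum \<mu> (n + (K + (p - 1))) = (\<Sum>X\<in>states. 1 * word_sum (\<lambda>w. \<mu> (X @ w)) (n + K))" for n
      using word_sum_\<mu>_prepend[OF K, of "n + K"] by (simp add: add.assoc)
    moreover have "has_ratio (\<lambda>n. \<Sum>X\<in>states. 1 * word_sum (\<lambda>w. \<mu> (X @ w)) (n + K))
        (\<Sum>X\<in>states. 1 * (\<theta> ^ K * V_entry forb rep m \<theta> X))"
      by (intro has_ratio_sum has_ratio_shift has_ratio_prepend)
    ultimately show "has_ratio (\<lambda>n. word_sum \<mu> (n + (K + (p - 1)))) (\<Sum>X\<in>states. 1 * (\<theta> ^ K * V_entry forb rep m \<theta> X))"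
      by simp
  qed
  then show False using V \<theta>_pos by simp
qed

end

section \<open>Identification of the growth rate with the Perron root\<close>

context weighted_words
begin

context
  fixes Ls :: "'a list list"
  assumes Ls: "distinct Ls" "set Ls = states" and ne: "allowed_word []"
begin

abbreviation adj :: "real mat" where "adj \<equiv> adj_mat_of forb rep m p Ls"

lemma sum_Ls: "(\<Sum>i<length Ls. \<phi> (Ls ! i)) = (\<Sum>X\<in>states. \<phi> X)"
  using Ls sum.reindex_bij_betw[OF bij_betw_nth[OF Ls(1) refl Ls(2)[symmetric]], of \<phi>]
  by (simp add: lessThan_atLeast0)

lemma Ls_nth: "i < length Ls \<Longrightarrow> Ls ! i \<in> states"
  using Ls(2) nth_mem by blast

lemma adj_carrier: "adj \<in> carrier_mat (length Ls) (length Ls)"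
  by (simp add: adj_mat_of_def)

lemma adj_nonneg: "i < length Ls \<Longrightarrow> j < length Ls \<Longrightarrow> adj $$ (i, j) \<ge> 0"
  by (simp add: adj_mat_of_def adj_entry_def)

lemma adj_index: "i < length Ls \<Longrightarrow> j < length Ls \<Longrightarrow> adj $$ (i, j) = weight (Ls ! i) (Ls ! j)"
  by (simp add: adj_mat_of_def)

text \<open>Column sums fit because the recursion for words ending with a state holds from length 0
  on. At \<open>k = 0\<close> a state has weight 1, being shorter than every repeated word.\<close>

lemma column_sum_pow_adj:
  "j < length Ls \<Longrightarrow> (\<Sum>i<length Ls. (adj ^\<^sub>m k) $$ (i, j)) = word_sum (\<lambda>w. \<mu> (w @ Ls ! j)) k"
proof (induction k arbitrary: j)
  case 0
  have "\<mu> (Ls ! j) = 1"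
    using states_clean[OF Ls_nth[OF 0]] two_le_p word_mult_short[of "Ls ! j"] by (simp add: \<mu>_def)
  moreover have "(\<Sum>i<length Ls. (adj ^\<^sub>m 0) $$ (i, j)) = (\<Sum>i<length Ls. if i = j then 1 else 0)"
    using 0 adj_carrier by (intro sum.cong) auto
  ultimately show ?case using 0 by (simp add: word_sum_def)
next
  case (Suc k)
  have Ak: "adj ^\<^sub>m k \<in> carrier_mat (length Ls) (length Ls)" using adj_carrier by simp
  have "(\<Sum>i<length Ls. (adj ^\<^sub>m Suc k) $$ (i, j))
      = (\<Sum>i<length Ls. \<Sum>l<length Ls. (adj ^\<^sub>m k) $$ (i, l) * adj $$ (l, j))"
    using Ak adj_carrier Suc.prems by (intro sum.cong) (simp_all add: scalar_prod_def lessThan_atLeast0)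
  also have "\<dots> = (\<Sum>l<length Ls. (\<Sum>i<length Ls. (adj ^\<^sub>m k) $$ (i, l)) * adj $$ (l, j))"
    unfolding sum_distrib_right by (rule sum.swap)
  also have "\<dots> = (\<Sum>l<length Ls. word_sum (\<lambda>w. \<mu> (w @ Ls ! l)) k * weight (Ls ! l) (Ls ! j))"
    using Suc by (intro sum.cong) (simp_all add: adj_index)
  also have "\<dots> = word_sum (\<lambda>w. \<mu> (w @ Ls ! j)) (Suc k)"
    unfolding word_sum_append_Suc[OF Ls_nth[OF Suc.prems]] by (rule sum_Ls)
  finally show ?case .
qed

lemma entry_sum_pow_adj: "entry_sum (adj ^\<^sub>m k) = (\<Sum>X\<in>states. word_sum (\<lambda>w. \<mu> (w @ X)) k)"
proof -
  have dim: "dim_row (adj ^\<^sub>m k) = length Ls" "dim_col (adj ^\<^sub>m k) = length Ls"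
    using pow_carrier_mat[OF adj_carrier, of k] by auto
  have "entry_sum (adj ^\<^sub>m k) = (\<Sum>j<length Ls. \<Sum>i<length Ls. (adj ^\<^sub>m k) $$ (i, j))"
    unfolding entry_sum_def dim by (rule sum.swap)
  also have "\<dots> = (\<Sum>j<length Ls. word_sum (\<lambda>w. \<mu> (w @ Ls ! j)) k)"
    by (intro sum.cong refl column_sum_pow_adj) simp
  also have "\<dots> = (\<Sum>X\<in>states. word_sum (\<lambda>w. \<mu> (w @ X)) k)" by (rule sum_Ls)
  finally show ?thesis .
qed

lemma length_Ls_pos: "length Ls > 0"
  using one_le_sum_states_append[OF ne, of 0] Ls(2) by (cases Ls) auto

text \<open>The coefficients of G and the entry sums of the powers bound each other up to an index
  shift and a constant, so they share convergence and divergence. The entry sums are at least 1; a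
  root below 1 would make them summable.\<close>

lemma weighted_words_radius_perron: "weighted_words_radius forb rep m p (perron_root adj)"
proof
  let ?\<theta> = "perron_root adj"
  let ?s = "\<lambda>k. entry_sum (adj ^\<^sub>m k)"
  note sp = adj_carrier length_Ls_pos adj_nonneg
  have s1: "?s k \<ge> 1" for k using one_le_sum_states_append[OF ne] by (simp add: entry_sum_pow_adj)
  have "?\<theta> \<ge> 1"
  proof (rule ccontr)
    assume "\<not> ?\<theta> \<ge> 1"
    then have "summable (\<lambda>k. ?s k / 1 ^ k)" by (intro summable_entry_sum[OF adj_carrier length_Ls_pos]) simp_all
    from summable_LIMSEQ_zero[OF this] have "?s \<longlonglongrightarrow> 0" by simp
    then have "1 \<le> (0 :: real)" by (rule LIMSEQ_le_const) (use s1 in blast)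
    then show False by simp
  qed
  then show pos: "?\<theta> > 0" by simp
  obtain K where K: "\<forall>Y v. length Y = p - 1 \<longrightarrow> Y \<notin> states \<longrightarrow> K \<le> length v \<longrightarrow> \<not> clean (Y @ v)"
    using bounded_extension by blast
  obtain C where C: "\<And>n. word_sum \<mu> (n + (p - 1 + K)) \<le> C * ?s n"
    using word_sum_\<mu>_le[OF K] unfolding entry_sum_pow_adj by blast
  show sm: "summable (\<lambda>n. word_sum \<mu> n / z ^ n)" if z: "z > ?\<theta>" for z
  proof -
    have z0: "z > 0" using z pos by simp
    have "summable (\<lambda>n. C * ?s n / z ^ n)"
      using summable_mult[OF summable_entry_sum[OF adj_carrier length_Ls_pos z], of C] by simp
    from summable_gser_comparison[OF z0 this _ C]
    have "summable (\<lambda>n. word_sum \<mu> (n + (p - 1 + K)) / z ^ n)"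
      by (simp add: word_sum_nonneg \<mu>_nonneg)
    then show ?thesis using z0 by (subst (asm) summable_gser_shift) auto
  qed
  show "filterlim (gser (word_sum \<mu>)) at_top (at_right ?\<theta>)"
  proof (rule gser_at_top[OF pos _ sm])
    show "\<not> summable (\<lambda>n. word_sum \<mu> n / ?\<theta> ^ n)"
    proof
      assume "summable (\<lambda>n. word_sum \<mu> n / ?\<theta> ^ n)"
      then have "summable (\<lambda>n. word_sum \<mu> (n + (p - 1)) / ?\<theta> ^ n)" using pos by (subst summable_gser_shift) auto
      moreover have "0 \<le> ?s n" for n using s1[of n] by simp
      moreover have "?s n \<le> word_sum \<mu> (n + (p - 1))" for n
        unfolding entry_sum_pow_adj by (rule sum_states_append_le)
      ultimately have "summable (\<lambda>n. ?s n / ?\<theta> ^ n)"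
        by (rule summable_gser_comparison[OF pos])
      then show False using not_summable_entry_sum[OF sp pos] by simp
    qed
  qed (simp_all add: word_sum_nonneg \<mu>_nonneg)
qed

lemma perron_eigenvectors:
  "eigenvector (transpose_mat adj) (vec (length Ls) (\<lambda>k. U_entry forb rep m (perron_root adj) (Ls ! k))) (perron_root adj)
   \<and> eigenvector adj (vec (length Ls) (\<lambda>k. V_entry forb rep m (perron_root adj) (Ls ! k))) (perron_root adj)"
proof -
  interpret weighted_words_radius forb rep m p "perron_root adj" by (rule weighted_words_radius_perron)
  let ?\<theta> = "perron_root adj"
  let ?U = "vec (length Ls) (\<lambda>k. U_entry forb rep m ?\<theta> (Ls ! k))"
  let ?V = "vec (length Ls) (\<lambda>k. V_entry forb rep m ?\<theta> (Ls ! k))"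
  have nz: "vec (length Ls) (\<lambda>k. \<phi> (Ls ! k)) \<noteq> 0\<^sub>v (length Ls)" if ex: "\<exists>X\<in>states. \<phi> X \<noteq> 0" for \<phi> :: "'a list \<Rightarrow> real"
  proof -
    obtain X where "X \<in> set Ls" and X: "\<phi> X \<noteq> 0" using ex Ls(2) by blast
    then obtain k where k: "k < length Ls" "Ls ! k = X" by (auto simp: in_set_conv_nth)
    then have "vec (length Ls) (\<lambda>k. \<phi> (Ls ! k)) $ k \<noteq> 0\<^sub>v (length Ls) $ k" using X by simp
    then show ?thesis by (rule contrapos_nn) simp
  qed
  have "transpose_mat adj *\<^sub>v ?U = ?\<theta> \<cdot>\<^sub>v ?U"
  proof (rule eq_vecI)
    fix j assume "j < dim_vec (?\<theta> \<cdot>\<^sub>v ?U)"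
    then have j: "j < length Ls" by simp
    have "(transpose_mat adj *\<^sub>v ?U) $ j = (\<Sum>i<length Ls. weight (Ls ! i) (Ls ! j) * U_entry forb rep m ?\<theta> (Ls ! i))"
      using j adj_carrier by (simp add: scalar_prod_def lessThan_atLeast0 adj_index)
    also have "\<dots> = (?\<theta> \<cdot>\<^sub>v ?U) $ j"
      unfolding sum_Ls[of "\<lambda>X. weight X (Ls ! j) * U_entry forb rep m ?\<theta> X"] using j U_eigen[OF Ls_nth[OF j]] by simp
    finally show "(transpose_mat adj *\<^sub>v ?U) $ j = (?\<theta> \<cdot>\<^sub>v ?U) $ j" .
  qed (use adj_carrier in simp)
  moreover have "adj *\<^sub>v ?V = ?\<theta> \<cdot>\<^sub>v ?V"
  proof (rule eq_vecI)
    fix j assume "j < dim_vec (?\<theta> \<cdot>\<^sub>v ?V)"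
    then have j: "j < length Ls" by simp
    have "(adj *\<^sub>v ?V) $ j = (\<Sum>i<length Ls. weight (Ls ! j) (Ls ! i) * V_entry forb rep m ?\<theta> (Ls ! i))"
      using j adj_carrier by (simp add: scalar_prod_def lessThan_atLeast0 adj_index)
    also have "\<dots> = (?\<theta> \<cdot>\<^sub>v ?V) $ j"
      unfolding sum_Ls[of "\<lambda>X. weight (Ls ! j) X * V_entry forb rep m ?\<theta> X"] using j V_eigen[OF Ls_nth[OF j]] by simp
    finally show "(adj *\<^sub>v ?V) $ j = (?\<theta> \<cdot>\<^sub>v ?V) $ j" .
  qed (use adj_carrier in simp)
  ultimately show ?thesis
    using nz[OF U_nonzero] nz[OF V_nonzero] adj_carrier by (simp add: eigenvector_def)
qed

end
end

theorem theorem5p3: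
  fixes forb rep Ls :: "'a::finite list list"
    and m :: "nat \<Rightarrow> nat" and p :: nat and \<theta> :: real and A :: "real mat"
  assumes "card (UNIV :: 'a set) \<ge> 2"
    and "distinct forb" and "reduced (set forb)" and "\<forall>a\<in>set forb. length a \<ge> 2"
    and "\<forall>c::'a. allowed (set forb) [c]"
    and "irreducible_shift (set forb)"
    and "distinct rep" and "reduced (set rep)" and "\<forall>r\<in>set rep. allowed (set forb) r"
    and "\<forall>i<length rep. m i \<ge> 2"
    and "set forb \<union> set rep \<noteq> {}"
    and "p = Max (length ` (set forb \<union> set rep))" and "p \<ge> 2"
    and "\<forall>r\<in>set rep. length r = p"
    and "distinct Ls" and "set Ls = lang (set forb) (p - 1)"
    and "A = adj_mat_of forb rep m p Ls"
    and "\<theta> = perron_root A"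
  shows "eigenvector (transpose_mat A) (vec (length Ls) (\<lambda>k. U_entry forb rep m \<theta> (Ls ! k))) \<theta>
       \<and> eigenvector A (vec (length Ls) (\<lambda>k. V_entry forb rep m \<theta> (Ls ! k))) \<theta>"
proof -
  have le_p: "length u \<le> p" if "u \<in> set forb \<union> set rep" for u
    unfolding assms(12) using that by (intro Max_ge) auto
  have no_forb_in_rep: "\<not> sublist a r" if a: "a \<in> set forb" and r: "r \<in> set rep" for a r
  proof
    assume "sublist a r"
    then have "allowed (set forb) a" using assms(9) r allowed_sublist by blast
    then show False using a by (auto simp: allowed_def subshift_def)
  qed
  \<comment> \<open>A repeated word already has the maximal length \<open>p\<close>, so a forbidden
    word containing it is equal to it. Allowedness of \<open>rep\<close> handles the opposite
    containment, and together they give joint reducedness.\<close>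
  have rep_in_forb: "u = v" if uv: "u \<in> set rep" "v \<in> set forb" "sublist u v" for u v
  proof -
    obtain s t where v: "v = s @ u @ t" using uv(3) by (auto simp: sublist_def)
    have "length v \<le> length u" using le_p[of v] assms(14) uv(1,2) by simp
    then show ?thesis by (simp add: v)
  qed
  interpret weighted_words forb rep m p
  proof
    show "distinct (rep @ forb)"
      using assms(2,7) no_forb_in_rep by (simp add: disjoint_iff) blast
    show "u = v" if "u \<in> set (rep @ forb)" "v \<in> set (rep @ forb)" "sublist u v" for u v
    proof -
      consider "u \<in> set rep" "v \<in> set rep" | "u \<in> set rep" "v \<in> set forb"
        | "u \<in> set forb" "v \<in> set rep" | "u \<in> set forb" "v \<in> set forb"
        using \<open>u \<in> set (rep @ forb)\<close> \<open>v \<in> set (rep @ forb)\<close> by (simp only: set_append Un_iff) blast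
      then show ?thesis
        using assms(3,8) no_forb_in_rep rep_in_forb \<open>sublist u v\<close> by cases (unfold reduced_def, blast+)
    qed
    show "length a \<ge> 2 \<and> length a \<le> p" if "a \<in> set forb" for a
      using that assms(4) le_p by simp
  qed (use assms(10,13,14) in simp_all)
  \<comment> \<open>Allowedness of the empty word says that the subshift is nonempty; any symbol
    witnesses it.\<close>
  have "allowed (set forb) []" using allowed_sublist[of "set forb" "[undefined]" "[]"] assms(5) by simp
  moreover have "set Ls = states" unfolding states_def by (rule assms(16))
  ultimately show ?thesis
    unfolding assms(18) unfolding assms(17) using assms(15) by (intro perron_eigenvectors)
qed

end
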